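(* Let $\Phi$ be a root system of rank $r$ with Weyl group $W$, weight space $\Lambda_{\mathbb{R}}$, $W$-invariant inner product $(\cdot,\cdot)$ and simple roots $\alpha_1,\dots,\alpha_r$. Let $x\in\Lambda_{\mathbb{R}}$, and let $\lambda\in\Lambda_{\mathbb{R}}$ be a regular weight. The volume of the weight polytope $P_W(x)$ is equal to $$\mathrm{Vol}\,P_W(x)=\frac{1}{r!}\sum_{w\in W}\frac{(\lambda,w(x))^r}{(\lambda,w(\alpha_1))\cdots(\lambda,w(\alpha_r))}.$$
   Context: $\Phi$ is a root system of rank $r$, $\Lambda$ is the associated integer weight lattice, $\Lambda_{\mathbb{R}}=\Lambda\otimes\mathbb{R}$ is the weight space, $W$ is the associated Weyl group, acting on $\Lambda_{\mathbb{R}}$, and $(x,y)$ is a nondegenerate $W$-invariant inner product on $\Lambda_{\mathbb{R}}$. A choice of simple roots $\alpha_1,\dots,\alpha_r$ in $\Phi$ is fixed. For $x\in\Lambda_{\mathbb{R}}$ the weight polytope is the convex hull of a Weyl group orbit, $P_W(x)=\mathrm{ConvexHull}(w(x)\mid w\in W)\subset\Lambda_{\mathbb{R}}$. $\mathrm{Vol}$ is the volume form on $\Lambda_{\mathbb{R}}$ normalized so that the parallelepiped generated by the simple roots $\alpha_i$ has volume $1$. A weight $\lambda\in\Lambda_{\mathbb{R}}$ is called regular if $(\lambda,\alpha)\neq0$ for any root $\alpha\in\Phi$.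
   Formalization: The formal statement assumes in addition that x is dominant, (x, α_i) ≥ 0 for all simple roots; for arbitrary x the formula fails (type A1, λ = 1, x = −1 gives −2), and every W-orbit contains a dominant point. *)

theory Defs
  imports "HOL-Analysis.Analysis"
begin

text \<open>The weight space is a Euclidean space \<open>'a\<close>, and the inner product of \<open>'a\<close> is the
  Weyl-group-invariant one: a reflection in a Weyl group, being of finite order, is the orthogonal
  reflection with respect to every invariant inner product.\<close>

definition reflection :: "'a::euclidean_space \<Rightarrow> 'a \<Rightarrow> 'a" where
  "reflection \<alpha> x = x - (2 * (x \<bullet> \<alpha>) / (\<alpha> \<bullet> \<alpha>)) *\<^sub>R \<alpha>"

text \<open>Crystallographic root systems, as in Bourbaki; reducedness is not required.\<close>

definition root_system :: "'a::euclidean_space set \<Rightarrow> bool" where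
  "root_system \<Phi> \<longleftrightarrow>
     finite \<Phi> \<and> 0 \<notin> \<Phi> \<and> span \<Phi> = UNIV \<and>
     (\<forall>\<alpha>\<in>\<Phi>. reflection \<alpha> ` \<Phi> = \<Phi>) \<and>
     (\<forall>\<alpha>\<in>\<Phi>. \<forall>\<beta>\<in>\<Phi>. 2 * (\<beta> \<bullet> \<alpha>) / (\<alpha> \<bullet> \<alpha>) \<in> \<int>)"

definition simple_roots :: "'a::euclidean_space set \<Rightarrow> 'a set \<Rightarrow> bool" where
  "simple_roots \<Phi> \<Delta> \<longleftrightarrow>
     \<Delta> \<subseteq> \<Phi> \<and> independent \<Delta> \<and> span \<Delta> = UNIV \<and>
     (\<forall>\<beta>\<in>\<Phi>. \<exists>c::'a \<Rightarrow> nat.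
        \<beta> = (\<Sum>\<alpha>\<in>\<Delta>. real (c \<alpha>) *\<^sub>R \<alpha>) \<or> \<beta> = - (\<Sum>\<alpha>\<in>\<Delta>. real (c \<alpha>) *\<^sub>R \<alpha>))"

text \<open>Reflections in roots are involutions, so the monoid they generate is a group.\<close>

inductive_set weyl_group :: "'a::euclidean_space set \<Rightarrow> ('a \<Rightarrow> 'a) set"
  for \<Phi> :: "'a set" where
  id: "id \<in> weyl_group \<Phi>"
| refl: "\<alpha> \<in> \<Phi> \<Longrightarrow> w \<in> weyl_group \<Phi> \<Longrightarrow> reflection \<alpha> \<circ> w \<in> weyl_group \<Phi>"

definition weight_polytope :: "'a::euclidean_space set \<Rightarrow> 'a \<Rightarrow> 'a set" where
  "weight_polytope \<Phi> x = convex hull ((\<lambda>w. w x) ` weyl_group \<Phi>)"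

definition regular_weight :: "'a::euclidean_space set \<Rightarrow> 'a \<Rightarrow> bool" where
  "regular_weight \<Phi> v \<longleftrightarrow> (\<forall>\<alpha>\<in>\<Phi>. v \<bullet> \<alpha> \<noteq> 0)"

text \<open>The right-hand side of the volume formula depends on which point of the orbit of \<open>x\<close> is used;
  it is the volume for the dominant one.  For the root system \<open>{1, -1}\<close> in the real line, with
  simple root 1, it evaluates to \<open>2 * x\<close>, which is negative for \<open>x < 0\<close>.\<close>

definition dominant_weight :: "'a::euclidean_space set \<Rightarrow> 'a \<Rightarrow> bool" where
  "dominant_weight \<Delta> x \<longleftrightarrow> (\<forall>\<alpha>\<in>\<Delta>. x \<bullet> \<alpha> \<ge> 0)"

definition parallelepiped :: "'a::euclidean_space set \<Rightarrow> 'a set" where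
  "parallelepiped \<Delta> = {\<Sum>\<alpha>\<in>\<Delta>. c \<alpha> *\<^sub>R \<alpha> | c. \<forall>\<alpha>\<in>\<Delta>. 0 \<le> c \<alpha> \<and> c \<alpha> \<le> 1}"

text \<open>Volume normalized so that the parallelepiped generated by \<open>\<Delta>\<close> has volume 1; the divisor is
  nonzero when \<open>\<Delta>\<close> is a basis.\<close>

definition Vol :: "'a::euclidean_space set \<Rightarrow> 'a set \<Rightarrow> real" where
  "Vol \<Delta> S = measure lebesgue S / measure lebesgue (parallelepiped \<Delta>)"

end

theory Submission
  imports Defs "HOL-Computational_Algebra.Polynomial"
begin

text \<open>For a regular vector \<open>\<mu>\<close>, Lawrence's decomposition writes the indicator of the polytope as
  a signed sum over \<open>w\<close> of indicators of the cones at the points \<open>w x\<close> with generators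
  \<open>- w \<alpha>\<close>, where each generator on which \<open>\<mu>\<close> increases is reversed (and counted with a sign).
  At a point of the polytope only the unflipped cone counts, and exactly one \<open>w\<close> has it.  At a point
  \<open>y\<close> outside, every term vanishes when \<open>\<mu>\<close> separates \<open>y\<close> from the polytope; and the
  signed sum does not depend on \<open>\<mu>\<close>, because when \<open>\<mu>\<close> crosses a wall the changes of the terms
  cancel in pairs \<open>w\<close>, \<open>w \<circ> reflection \<alpha>\<close>.

  All cones of the decomposition for \<open>\<mu> = \<lambda>\<close> lie on one side, so cutting them by
  \<open>\<lambda> \<bullet> y \<ge> - M\<close> leaves simplices of volume
  \<open>(\<lambda> \<bullet> w x + M) ^ r / (r! \<Prod>\<alpha>. \<bar>\<lambda> \<bullet> w \<alpha>\<bar>)\<close>.  Their signed sum is a polynomial in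
  \<open>M\<close> that is constant for large \<open>M\<close>, so \<open>M = 0\<close> gives the same value.  Below, the sums run
  over the inverses of the \<open>w\<close>, so that \<open>w\<close> acts on \<open>\<lambda>\<close> and \<open>y\<close> and the apex stays at
  \<open>x\<close>.\<close>

subsection \<open>Linear images and volume\<close>

lemma nn_integral_lborel_translate:
  fixes f :: "'a::euclidean_space \<Rightarrow> ennreal"
  assumes [measurable]: "f \<in> borel_measurable borel"
  shows "(\<integral>\<^sup>+x. f (c + x) \<partial>lborel) = (\<integral>\<^sup>+x. f x \<partial>lborel)"
proof -
  have "(\<integral>\<^sup>+x. f x \<partial>lborel) = (\<integral>\<^sup>+x. f x \<partial>distr lborel borel ((+) c))"
    by (simp add: lborel_distr_plus)
  also have "\<dots> = (\<integral>\<^sup>+x. f (c + x) \<partial>lborel)"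
    by (rule nn_integral_distr) auto
  finally show ?thesis ..
qed

text \<open>Uniqueness of Haar measure: both sides are the double integral of
  \<open>F (h x + y) * g y\<close>, evaluated by Fubini and translations in the two orders.
  Translating \<open>x\<close> by \<open>inv h y\<close> shifts \<open>h x\<close> by
  \<open>y\<close>. With \<open>g\<close> fixed, \<open>h\<close> scales all integrals by one
  constant.\<close>

lemma nn_integral_lborel_linear:
  fixes F g :: "'a::euclidean_space \<Rightarrow> ennreal" and h :: "'a \<Rightarrow> 'a"
  assumes h: "linear h" "bij h"
    and [measurable]: "F \<in> borel_measurable borel" "g \<in> borel_measurable borel"
  shows "(\<integral>\<^sup>+x. F (h x) \<partial>lborel) * (\<integral>\<^sup>+y. g y \<partial>lborel)
       = (\<integral>\<^sup>+y. F y \<partial>lborel) * (\<integral>\<^sup>+x. g (- h x) \<partial>lborel)"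
proof -
  have [measurable]: "h \<in> borel_measurable borel"
    using h(1) linear_continuous_on linear_conv_bounded_linear
    by (intro borel_measurable_continuous_onI) blast
  have h_inv: "h (inv h y + x) = y + h x" for x y
    using h by (simp add: linear_add bij_is_surj surj_f_inv_f)
  have h_inv': "h (inv h y + x) = h x + y" for x y
    using h_inv by (simp add: add.commute)
  have "(\<integral>\<^sup>+x. F (h x) \<partial>lborel) * (\<integral>\<^sup>+y. g y \<partial>lborel)
      = (\<integral>\<^sup>+y. \<integral>\<^sup>+x. F (h x) * g y \<partial>lborel \<partial>lborel)"
    by (simp add: nn_integral_cmult nn_integral_multc)
  also have "\<dots> = (\<integral>\<^sup>+y. \<integral>\<^sup>+x. F (h x + y) * g y \<partial>lborel \<partial>lborel)"
  proof (rule nn_integral_cong)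
    fix y :: 'a
    show "(\<integral>\<^sup>+x. F (h x) * g y \<partial>lborel) = (\<integral>\<^sup>+x. F (h x + y) * g y \<partial>lborel)"
      using nn_integral_lborel_translate[of "\<lambda>x. F (h x) * g y" "inv h y"] by (simp add: h_inv')
  qed
  also have "\<dots> = (\<integral>\<^sup>+x. \<integral>\<^sup>+y. F (h x + y) * g y \<partial>lborel \<partial>lborel)"
    by (rule lborel_pair.Fubini') measurable
  also have "\<dots> = (\<integral>\<^sup>+x. \<integral>\<^sup>+y. F y * g (y - h x) \<partial>lborel \<partial>lborel)"
  proof (rule nn_integral_cong)
    fix x :: 'a
    show "(\<integral>\<^sup>+y. F (h x + y) * g y \<partial>lborel) = (\<integral>\<^sup>+y. F y * g (y - h x) \<partial>lborel)"
      using nn_integral_lborel_translate[of "\<lambda>y. F y * g (y - h x)" "h x"] by simp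
  qed
  also have "\<dots> = (\<integral>\<^sup>+y. \<integral>\<^sup>+x. F y * g (y - h x) \<partial>lborel \<partial>lborel)"
    by (rule lborel_pair.Fubini') measurable
  also have "\<dots> = (\<integral>\<^sup>+y. \<integral>\<^sup>+x. F y * g (- h x) \<partial>lborel \<partial>lborel)"
  proof (rule nn_integral_cong)
    fix y :: 'a
    show "(\<integral>\<^sup>+x. F y * g (y - h x) \<partial>lborel) = (\<integral>\<^sup>+x. F y * g (- h x) \<partial>lborel)"
      using nn_integral_lborel_translate[of "\<lambda>x. F y * g (y - h x)" "inv h y"] by (simp add: h_inv)
  qed
  also have "\<dots> = (\<integral>\<^sup>+y. F y \<partial>lborel) * (\<integral>\<^sup>+x. g (- h x) \<partial>lborel)"
    by (simp add: nn_integral_cmult nn_integral_multc)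
  finally show ?thesis .
qed

text \<open>The factor stays abstract, without a determinant. Each use identifies it on one test
  set: the unit ball for orthogonal maps, the unit cube for diagonal maps and for the change to the
  basis of simple roots.\<close>

lemma measure_linear_image_compact:
  fixes f :: "'a::euclidean_space \<Rightarrow> 'a"
  assumes f: "linear f" "inj f"
  obtains c where "c > 0" "\<And>S. compact S \<Longrightarrow> measure lebesgue (f ` S) = c * measure lebesgue S"
proof -
  obtain h where h: "linear h" "h \<circ> f = id" "f \<circ> h = id"
    using linear_injective_isomorphism[OF f] by (metis eq_id_iff comp_apply)
  then have hf: "h (f x) = x" "f (h x) = x" for x by (metis comp_apply id_apply)+
  then have "bij h" by (metis bijI')
  \<comment> \<open>A weight of integral 1 turns the symmetric identity into a scaling rule with
    constant \<open>C\<close>.\<close>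
  define g :: "'a \<Rightarrow> ennreal" where "g = indicator (cbox 0 One)"
  define C where "C = (\<integral>\<^sup>+x. g (- h x) \<partial>lborel)"
  have g: "(\<integral>\<^sup>+y. g y \<partial>lborel) = 1" "g \<in> borel_measurable borel"
    by (simp_all add: g_def emeasure_lborel_cbox)
  have C: "measure lebesgue (f ` S) = enn2real C * measure lebesgue S" if S: "compact S" for S
  proof -
    have fS: "compact (f ` S)"
      using S f by (simp add: compact_continuous_image linear_continuous_on linear_linear)
    have "indicator (f ` S) y = (indicator S (h y) :: ennreal)" for y
      using hf by (auto simp: indicator_def image_iff) metis+
    then have "emeasure lborel (f ` S) = (\<integral>\<^sup>+y. indicator S (h y) \<partial>lborel)"
      using fS by (simp flip: nn_integral_indicator add: compact_imp_closed)
    also have "\<dots> = emeasure lborel S * C"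
      using nn_integral_lborel_linear[OF h(1) \<open>bij h\<close>, of "indicator S" g] S g
      by (simp add: C_def compact_imp_closed borel_measurable_indicator)
    finally have "measure lborel (f ` S) = enn2real C * measure lborel S"
      by (simp add: measure_def enn2real_mult)
    then show ?thesis
      using S fS by (simp add: measure_completion compact_imp_closed)
  qed
  \<comment> \<open>\<open>enn2real\<close> sends both 0 and infinity to 0. A compact set whose
    image is the unit ball rules out both values of \<open>C\<close>.\<close>
  have "f ` h ` cball 0 1 = cball 0 1" using hf by (simp add: image_image)
  moreover have "compact (h ` cball 0 1)"
    using h by (simp add: compact_continuous_image linear_continuous_on linear_linear)
  moreover have "measure lebesgue (cball (0::'a) 1) > 0"
    by (simp add: content_cball_pos measure_completion)
  ultimately have "enn2real C * measure lebesgue (h ` cball 0 1) > 0"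
    using C[of "h ` cball 0 1"] by metis
  then have "enn2real C > 0"
    by (simp add: zero_less_mult_iff not_less enn2real_nonneg)
  then show ?thesis using C that by blast
qed

lemma measure_orthogonal_image_compact:
  fixes f :: "'a::euclidean_space \<Rightarrow> 'a"
  assumes f: "orthogonal_transformation f" and S: "compact S"
  shows "measure lebesgue (f ` S) = measure lebesgue S"
proof -
  have "linear f" "inj f"
    using f by (simp_all add: orthogonal_transformation_linear orthogonal_transformation_inj)
  then obtain c where c: "\<And>S. compact S \<Longrightarrow> measure lebesgue (f ` S) = c * measure lebesgue S"
    using measure_linear_image_compact by blast
  have "measure lebesgue (cball (0::'a) 1) > 0"
    by (simp add: content_cball_pos measure_completion)
  moreover have "f ` cball 0 1 = cball 0 1"
    using image_orthogonal_transformation_cball[OF f, of 0 1] f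
    by (simp add: orthogonal_transformation_linear linear_0)
  ultimately have "c = 1"
    using c[of "cball 0 1"] by simp
  then show ?thesis using c[OF S] by simp
qed

lemma measure_diagonal_image_compact:
  fixes d :: "'a::euclidean_space \<Rightarrow> real"
  assumes d: "\<And>b. b \<in> Basis \<Longrightarrow> d b \<noteq> 0" and S: "compact S"
  shows "measure lebesgue ((\<lambda>x. \<Sum>b\<in>Basis. (d b * (x \<bullet> b)) *\<^sub>R b) ` S)
       = (\<Prod>b\<in>Basis. \<bar>d b\<bar>) * measure lebesgue S"
proof -
  define f :: "'a \<Rightarrow> 'a" where "f = (\<lambda>x. \<Sum>b\<in>Basis. (d b * (x \<bullet> b)) *\<^sub>R b)"
  have f_inner: "f x \<bullet> b = d b * (x \<bullet> b)" if "b \<in> Basis" for x b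
    using that by (simp add: f_def inner_sum_left inner_Basis if_distrib sum.delta cong: if_cong)
  have "linear f"
    by (rule linearI) (simp_all add: f_def inner_simps algebra_simps sum.distrib scaleR_sum_right)
  moreover have "inj f"
  proof (rule injI, rule euclidean_eqI)
    fix x y b :: 'a assume "f x = f y" "b \<in> Basis"
    then show "x \<bullet> b = y \<bullet> b" using f_inner[of b] d[of b] by (metis mult_cancel_left)
  qed
  ultimately obtain c where c: "\<And>S. compact S \<Longrightarrow> measure lebesgue (f ` S) = c * measure lebesgue S"
    using measure_linear_image_compact by blast
  have "compact (f ` cbox 0 One)"
    using \<open>linear f\<close> by (simp add: compact_continuous_image linear_continuous_on linear_linear)
  then have "measure lebesgue (f ` cbox 0 One) = (\<Prod>b\<in>Basis. \<bar>d b\<bar>)"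
    using content_image_stretch_interval[of d 0 One]
    by (simp add: measure_completion compact_imp_closed abs_prod f_def)
  then have "c = (\<Prod>b\<in>Basis. \<bar>d b\<bar>)"
    using c[of "cbox 0 One"] by simp
  then show ?thesis using c[OF S] by (simp add: f_def)
qed

subsection \<open>Simple roots\<close>

lemma reflection_inner: "reflection a x \<bullet> y = x \<bullet> reflection a y"
  by (simp add: reflection_def inner_simps inner_commute)

lemma reflection_reflection [simp]: "reflection a (reflection a x) = x"
  by (cases "a = 0") (simp_all add: reflection_def inner_simps algebra_simps)

lemma linear_reflection: "linear (reflection a)"
  by (rule linearI) (simp_all add: reflection_def inner_simps algebra_simps add_divide_distrib)

lemma orthogonal_transformation_reflection: "orthogonal_transformation (reflection a)"
  unfolding orthogonal_transformation_def
  by (simp add: linear_reflection reflection_inner)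

lemma reflection_self: "reflection a a = - a"
  by (cases "a = 0") (simp_all add: reflection_def scaleR_2)

text \<open>Root systems need not be reduced, so a root on the line of a simple root may be a proper
  multiple of it. This lemma identifies the reflections in such roots.\<close>

lemma reflection_scaleR: "c \<noteq> 0 \<Longrightarrow> reflection (c *\<^sub>R a) = reflection a"
  by (auto simp: reflection_def fun_eq_iff power2_eq_square field_simps)

lemma orthogonal_transformation_conj_reflection:
  assumes "orthogonal_transformation f"
  shows "f (reflection a x) = reflection (f a) (f x)"
proof -
  have "linear f" "\<And>v w. f v \<bullet> f w = v \<bullet> w"
    using assms by (auto simp: orthogonal_transformation_def)
  then show ?thesis by (simp add: reflection_def linear_diff linear_scale)
qed

locale simple_root_system =
  fixes \<Phi> \<Delta> :: "'a::euclidean_space set"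
  assumes root_system: "root_system \<Phi>" and simple_roots: "simple_roots \<Phi> \<Delta>"
begin

lemma finite_roots: "finite \<Phi>" and zero_notin_roots: "0 \<notin> \<Phi>" and span_roots: "span \<Phi> = UNIV"
  and reflection_root: "\<alpha> \<in> \<Phi> \<Longrightarrow> \<beta> \<in> \<Phi> \<Longrightarrow> reflection \<alpha> \<beta> \<in> \<Phi>"
  using root_system by (auto simp: root_system_def)

lemma simple_subset: "\<Delta> \<subseteq> \<Phi>" and independent_simple: "independent \<Delta>" and span_simple: "span \<Delta> = UNIV"
  using simple_roots by (auto simp: simple_roots_def)

lemma finite_simple: "finite \<Delta>"
  using finite_roots simple_subset finite_subset by blast

lemma simple_root: "\<alpha> \<in> \<Delta> \<Longrightarrow> \<alpha> \<in> \<Phi>"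
  using simple_subset by blast

lemma simple_nonzero: "\<alpha> \<in> \<Delta> \<Longrightarrow> \<alpha> \<noteq> 0"
  using simple_root zero_notin_roots by blast

lemma card_simple: "card \<Delta> = DIM('a)"
  using independent_simple span_simple by (metis dim_UNIV dim_span dim_eq_card_independent)

definition coef :: "'a \<Rightarrow> 'a \<Rightarrow> real" where
  "coef \<alpha> v = representation \<Delta> v \<alpha>"

lemma coef_add: "coef \<alpha> (v + w) = coef \<alpha> v + coef \<alpha> w"
  and coef_diff: "coef \<alpha> (v - w) = coef \<alpha> v - coef \<alpha> w"
  and coef_minus: "coef \<alpha> (- v) = - coef \<alpha> v"
  and coef_scaleR: "coef \<alpha> (c *\<^sub>R v) = c * coef \<alpha> v"
  and coef_sum: "coef \<alpha> (\<Sum>i\<in>I. f i) = (\<Sum>i\<in>I. coef \<alpha> (f i))"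
  and coef_zero: "coef \<alpha> 0 = 0"
  by (simp_all add: coef_def representation_add representation_diff representation_neg
      representation_scale representation_sum representation_zero independent_simple span_simple)

lemma coef_simple: "\<alpha> \<in> \<Delta> \<Longrightarrow> coef \<beta> \<alpha> = (if \<beta> = \<alpha> then 1 else 0)"
  using representation_basis[OF independent_simple, of \<alpha>] by (auto simp: coef_def)

lemma linear_coef: "linear (coef \<alpha>)"
  by (rule linearI) (simp_all add: coef_add coef_scaleR)

lemma sum_coef: "(\<Sum>\<alpha>\<in>\<Delta>. coef \<alpha> v *\<^sub>R \<alpha>) = v"
  unfolding coef_def
  by (rule sum_representation_eq[OF independent_simple]) (auto simp: span_simple finite_simple)

lemma inner_coef: "v \<bullet> w = (\<Sum>\<alpha>\<in>\<Delta>. coef \<alpha> w * (v \<bullet> \<alpha>))"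
  by (subst (1) sum_coef[symmetric, of w]) (simp add: inner_sum_right)

lemma coef_lincomb: "\<alpha> \<in> \<Delta> \<Longrightarrow> coef \<alpha> (\<Sum>\<beta>\<in>\<Delta>. c \<beta> *\<^sub>R \<beta>) = c \<alpha>"
  using finite_simple
  by (simp add: coef_sum coef_scaleR coef_simple if_distrib cong: if_cong)

text \<open>The closed cone spanned by \<Delta>. It contains 0, and \<open>pos (x - y)\<close> is
  the dominance order.\<close>

definition pos :: "'a \<Rightarrow> bool" where
  "pos v \<longleftrightarrow> (\<forall>\<alpha>\<in>\<Delta>. coef \<alpha> v \<ge> 0)"

text \<open>The natural coordinates are kept for the induction on heights; most later arguments use
  only the sign.\<close>

lemma root_cases:
  assumes "\<beta> \<in> \<Phi>"
  obtains c :: "'a \<Rightarrow> nat" where "pos \<beta>" "\<And>\<alpha>. \<alpha> \<in> \<Delta> \<Longrightarrow> coef \<alpha> \<beta> = real (c \<alpha>)"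
  | c :: "'a \<Rightarrow> nat" where "pos (- \<beta>)" "\<And>\<alpha>. \<alpha> \<in> \<Delta> \<Longrightarrow> coef \<alpha> (- \<beta>) = real (c \<alpha>)"
proof -
  obtain c :: "'a \<Rightarrow> nat" where
    "\<beta> = (\<Sum>\<alpha>\<in>\<Delta>. real (c \<alpha>) *\<^sub>R \<alpha>) \<or> - \<beta> = (\<Sum>\<alpha>\<in>\<Delta>. real (c \<alpha>) *\<^sub>R \<alpha>)"
    using simple_roots assms unfolding simple_roots_def by fastforce
  moreover have "pos v" "\<And>\<alpha>. \<alpha> \<in> \<Delta> \<Longrightarrow> coef \<alpha> v = real (c \<alpha>)"
    if "v = (\<Sum>\<alpha>\<in>\<Delta>. real (c \<alpha>) *\<^sub>R \<alpha>)" for v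
    using coef_lincomb[of _ "\<lambda>\<alpha>. real (c \<alpha>)"] that by (auto simp: pos_def)
  ultimately show ?thesis using that by blast
qed

lemma pos_or_neg: "\<beta> \<in> \<Phi> \<Longrightarrow> pos \<beta> \<or> pos (- \<beta>)"
  using root_cases by metis

lemma not_pos_and_neg: "v \<noteq> 0 \<Longrightarrow> \<not> (pos v \<and> pos (- v))"
proof
  assume "v \<noteq> 0" "pos v \<and> pos (- v)"
  then have "\<forall>\<alpha>\<in>\<Delta>. coef \<alpha> v = 0" by (force simp: pos_def coef_minus)
  then have "(\<Sum>\<alpha>\<in>\<Delta>. coef \<alpha> v *\<^sub>R \<alpha>) = 0" by simp
  then show False using \<open>v \<noteq> 0\<close> by (simp only: sum_coef)
qed

lemma pos_simple: "\<alpha> \<in> \<Delta> \<Longrightarrow> pos \<alpha>"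
  by (simp add: pos_def coef_simple)

text \<open>Adding a multiple of a simple root changes one coordinate only, and a root with one nonzero
  coordinate left keeps its sign.\<close>

lemma pos_add_simple_iff:
  assumes "\<beta> \<in> \<Phi>" "\<beta> + c *\<^sub>R \<alpha> \<in> \<Phi>" "\<alpha> \<in> \<Delta>" "\<beta> \<notin> span {\<alpha>}"
  shows "pos (\<beta> + c *\<^sub>R \<alpha>) \<longleftrightarrow> pos \<beta>"
proof -
  have "\<exists>\<gamma>\<in>\<Delta>. \<gamma> \<noteq> \<alpha> \<and> coef \<gamma> \<beta> \<noteq> 0"
  proof (rule ccontr)
    assume "\<not> ?thesis"
    then have "(\<Sum>\<gamma>\<in>\<Delta>. coef \<gamma> \<beta> *\<^sub>R \<gamma>) = (\<Sum>\<gamma>\<in>\<Delta>. if \<gamma> = \<alpha> then coef \<alpha> \<beta> *\<^sub>R \<alpha> else 0)"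
      by (intro sum.cong) auto
    also have "\<dots> = coef \<alpha> \<beta> *\<^sub>R \<alpha>"
      using assms(3) finite_simple by simp
    finally have "\<beta> = coef \<alpha> \<beta> *\<^sub>R \<alpha>" by (simp only: sum_coef)
    then have "\<beta> \<in> span {\<alpha>}" unfolding span_singleton by blast
    then show False using assms(4) by blast
  qed
  then obtain \<gamma> where \<gamma>: "\<gamma> \<in> \<Delta>" "\<gamma> \<noteq> \<alpha>" "coef \<gamma> \<beta> \<noteq> 0" by blast
  then have eq: "coef \<gamma> (\<beta> + c *\<^sub>R \<alpha>) = coef \<gamma> \<beta>"
    using assms(3) by (simp add: coef_add coef_scaleR coef_simple)
  have "pos v \<longleftrightarrow> coef \<gamma> v > 0" if "v \<in> \<Phi>" "coef \<gamma> v \<noteq> 0" for v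
  proof -
    have "coef \<gamma> v \<ge> 0" if "pos v" using that \<gamma>(1) by (simp add: pos_def)
    moreover have "coef \<gamma> v \<le> 0" if "pos (- v)" using that \<gamma>(1) by (simp add: pos_def coef_minus)
    ultimately show ?thesis using pos_or_neg[OF that(1)] that(2) by linarith
  qed
  from this[OF assms(1)] this[OF assms(2)] show ?thesis using \<gamma>(3) by (simp add: eq)
qed

lemma pos_reflection_simple_iff:
  assumes "\<beta> \<in> \<Phi>" "\<alpha> \<in> \<Delta>" "\<beta> \<notin> span {\<alpha>}"
  shows "pos (reflection \<alpha> \<beta>) \<longleftrightarrow> pos \<beta>"
  using pos_add_simple_iff[of \<beta> "- (2 * (\<beta> \<bullet> \<alpha>) / (\<alpha> \<bullet> \<alpha>))" \<alpha>]
    assms reflection_root[OF simple_root[OF assms(2)] assms(1)]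
  by (simp add: reflection_def)

subsection \<open>Words in simple reflections\<close>

text \<open>The list records the length of an expression, the induction measure of
  \<open>weyl_induct\<close>.\<close>

primrec word :: "'a list \<Rightarrow> 'a \<Rightarrow> 'a" where
  "word [] = id"
| "word (\<alpha> # xs) = reflection \<alpha> \<circ> word xs"

lemma word_append: "word (xs @ ys) = word xs \<circ> word ys"
  by (induction xs) (simp_all add: comp_assoc)

lemma word_rev: "word (rev xs) (word xs v) = v"
  by (induction xs arbitrary: v) (simp_all add: word_append)

lemma orthogonal_transformation_word: "orthogonal_transformation (word xs)"
proof (induction xs)
  case Nil then show ?case by (simp add: id_def)
next
  case (Cons a xs) then show ?case
    unfolding word.simps
    by (intro orthogonal_transformation_compose orthogonal_transformation_reflection)
qed

lemma word_root: "set xs \<subseteq> \<Phi> \<Longrightarrow> \<beta> \<in> \<Phi> \<Longrightarrow> word xs \<beta> \<in> \<Phi>"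
  by (induction xs) (auto simp: reflection_root)

lemma simple_word_root: "set xs \<subseteq> \<Delta> \<Longrightarrow> \<beta> \<in> \<Phi> \<Longrightarrow> word xs \<beta> \<in> \<Phi>"
  using simple_subset word_root by blast

text \<open>As the letters act on the positive root \<alpha> one by one, the sign is lost at some
  letter \<gamma>. A simple reflection changes the sign only of roots on its own line, so there the
  suffix takes \<alpha> to a multiple of \<gamma> and conjugates \<open>reflection \<alpha>\<close>
  to \<open>reflection \<gamma>\<close>. Multiplying by \<open>reflection \<alpha>\<close> on the
  right therefore deletes the letter \<gamma>.\<close>

lemma exchange:
  assumes "set xs \<subseteq> \<Delta>" "\<alpha> \<in> \<Delta>" "\<not> pos (word xs \<alpha>)"
  shows "\<exists>ys. set ys \<subseteq> \<Delta> \<and> length ys < length xs \<and> word ys = word xs \<circ> reflection \<alpha>"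
  using assms
proof (induction xs)
  case Nil
  then show ?case by (simp add: pos_simple)
next
  case (Cons \<gamma> xs)
  let ?v = "word xs"
  have v: "?v \<alpha> \<in> \<Phi>" using Cons.prems simple_word_root simple_root by simp
  show ?case
  proof (cases "pos (?v \<alpha>)")
    case False
    then obtain ys where "set ys \<subseteq> \<Delta>" "length ys < length xs" "word ys = ?v \<circ> reflection \<alpha>"
      using Cons.IH Cons.prems by (metis insert_subset list.simps(15))
    then show ?thesis
      using Cons.prems by (intro exI[of _ "\<gamma> # ys"]) (auto simp: comp_assoc)
  next
    case True
    then have "?v \<alpha> \<in> span {\<gamma>}"
      using pos_reflection_simple_iff[OF v] Cons.prems by auto
    then obtain c where c: "?v \<alpha> = c *\<^sub>R \<gamma>" by (auto simp: span_singleton)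
    then have "c \<noteq> 0" using v zero_notin_roots by auto
    have "reflection \<gamma> (?v (reflection \<alpha> x)) = ?v x" for x
      using orthogonal_transformation_conj_reflection[OF orthogonal_transformation_word, of xs \<alpha> x]
        reflection_scaleR[OF \<open>c \<noteq> 0\<close>, of \<gamma>] by (simp add: c)
    then show ?thesis
      using Cons.prems by (intro exI[of _ xs]) (auto simp: fun_eq_iff)
  qed
qed

text \<open>Induction on the height, the sum of the coordinates. Since \<beta> \<bullet> \<beta> > 0
  and the coordinates are nonnegative, some simple root pairs positively with \<beta>. Its
  reflection lowers the height and keeps \<beta> positive, unless \<beta> already lies on the line
  of a simple root.\<close>

lemma pos_root_conj_simple:
  assumes "\<beta> \<in> \<Phi>" "pos \<beta>"
  shows "\<exists>xs \<alpha> c. set xs \<subseteq> \<Delta> \<and> \<alpha> \<in> \<Delta> \<and> word xs \<beta> = c *\<^sub>R \<alpha>"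
  using assms
proof (induction "nat \<lfloor>\<Sum>\<alpha>\<in>\<Delta>. coef \<alpha> \<beta>\<rfloor>" arbitrary: \<beta> rule: less_induct)
  case less
  show ?case
  proof (cases "\<exists>\<alpha>\<in>\<Delta>. \<beta> \<in> span {\<alpha>}")
    case True
    then obtain \<alpha> c where "\<alpha> \<in> \<Delta>" "\<beta> = c *\<^sub>R \<alpha>" by (auto simp: span_singleton)
    then show ?thesis by (intro exI[of _ "[]"]) auto
  next
    case False
    have "\<exists>\<alpha>\<in>\<Delta>. \<beta> \<bullet> \<alpha> > 0"
    proof (rule ccontr)
      assume "\<not> ?thesis"
      then have "\<beta> \<bullet> \<beta> \<le> 0"
        unfolding inner_coef[of \<beta> \<beta>] using less.prems(2)
        by (intro sum_nonpos) (auto simp: pos_def mult_le_0_iff)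
      then show False using less.prems(1) zero_notin_roots by (metis inner_gt_zero_iff not_less)
    qed
    then obtain \<alpha> where \<alpha>: "\<alpha> \<in> \<Delta>" "\<beta> \<bullet> \<alpha> > 0" by blast
    let ?\<gamma> = "reflection \<alpha> \<beta>" and ?k = "2 * (\<beta> \<bullet> \<alpha>) / (\<alpha> \<bullet> \<alpha>)"
    have \<gamma>: "?\<gamma> \<in> \<Phi>" "pos ?\<gamma>"
      using less.prems \<alpha> False reflection_root simple_root pos_reflection_simple_iff by auto
    \<comment> \<open>Integral heights make the positive drop \<open>?k\<close> a strict drop of the
      natural number on which the induction runs.\<close>
    have int: "(\<Sum>\<delta>\<in>\<Delta>. coef \<delta> v) \<in> \<int>" if "v \<in> \<Phi>" "pos v" for v
    proof -
      have "coef \<delta> v \<in> \<int>" if "\<delta> \<in> \<Delta>" for \<delta>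
        using \<open>v \<in> \<Phi>\<close>
      proof (cases rule: root_cases)
        case (1 c) then show ?thesis using that by simp
      next
        case (2 c) then have "coef \<delta> v = - real (c \<delta>)" using 2(2)[OF that] coef_minus[of \<delta> v] by linarith
        then show ?thesis by simp
      qed
      then show ?thesis by (intro Ints_sum) auto
    qed
    have "(\<Sum>\<delta>\<in>\<Delta>. coef \<delta> ?\<gamma>) = (\<Sum>\<delta>\<in>\<Delta>. coef \<delta> \<beta>) - ?k"
    proof -
      have "(\<Sum>\<delta>\<in>\<Delta>. coef \<delta> ?\<gamma>) = (\<Sum>\<delta>\<in>\<Delta>. coef \<delta> \<beta> - (if \<delta> = \<alpha> then ?k else 0))"
        using \<alpha>(1) by (intro sum.cong) (auto simp: reflection_def coef_diff coef_scaleR coef_simple)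
      then show ?thesis
        using \<alpha>(1) finite_simple by (simp add: sum_subtractf)
    qed
    moreover have "?k > 0" using \<alpha> simple_nonzero by simp
    moreover have "(\<Sum>\<delta>\<in>\<Delta>. coef \<delta> ?\<gamma>) \<ge> 0"
      using \<gamma> by (intro sum_nonneg) (auto simp: pos_def)
    ultimately have "nat \<lfloor>\<Sum>\<delta>\<in>\<Delta>. coef \<delta> ?\<gamma>\<rfloor> < nat \<lfloor>\<Sum>\<delta>\<in>\<Delta>. coef \<delta> \<beta>\<rfloor>"
      using int[OF \<gamma>] int[OF less.prems] by (auto elim!: Ints_cases)
    from less.hyps[OF this \<gamma>] obtain xs \<delta> c
      where "set xs \<subseteq> \<Delta>" "\<delta> \<in> \<Delta>" "word xs ?\<gamma> = c *\<^sub>R \<delta>" by blast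
    then show ?thesis
      using \<alpha> by (intro exI[of _ "xs @ [\<alpha>]"] exI[of _ \<delta>] exI[of _ c]) (auto simp: word_append)
  qed
qed

text \<open>A word taking \<beta> to a multiple of a simple root conjugates the reflection in
  \<beta> to a simple one. A negative root shares its reflection with its opposite.\<close>

lemma reflection_eq_word:
  assumes "\<beta> \<in> \<Phi>"
  shows "\<exists>xs. set xs \<subseteq> \<Delta> \<and> reflection \<beta> = word xs"
proof -
  have "\<exists>xs. set xs \<subseteq> \<Delta> \<and> reflection \<beta> = word xs" if \<beta>: "\<beta> \<in> \<Phi>" "pos \<beta>" for \<beta>
  proof -
    obtain xs \<alpha> c where xs: "set xs \<subseteq> \<Delta>" "\<alpha> \<in> \<Delta>" "word xs \<beta> = c *\<^sub>R \<alpha>"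
      using pos_root_conj_simple[OF \<beta>] by blast
    have "word xs \<beta> \<in> \<Phi>" using xs(1) \<beta>(1) by (rule simple_word_root)
    then have "c \<noteq> 0" using xs(3) zero_notin_roots by auto
    have "word xs (reflection \<beta> x) = reflection \<alpha> (word xs x)" for x
      using orthogonal_transformation_conj_reflection[OF orthogonal_transformation_word, of xs \<beta> x]
        xs(3) reflection_scaleR[OF \<open>c \<noteq> 0\<close>, of \<alpha>] by simp
    then have "reflection \<beta> x = word (rev xs @ \<alpha> # xs) x" for x
      using word_rev[of xs "reflection \<beta> x"] by (simp add: word_append)
    then show ?thesis
      using xs by (intro exI[of _ "rev xs @ \<alpha> # xs"]) auto
  qed
  moreover have "reflection (- \<beta>) = reflection \<beta>"
    using reflection_scaleR[of "-1" \<beta>] by simp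
  moreover have "- \<beta> \<in> \<Phi>" using assms reflection_root[OF assms assms] by (simp add: reflection_self)
  ultimately show ?thesis using assms pos_or_neg by metis
qed

lemma weyl_group_word:
  assumes "w \<in> weyl_group \<Phi>"
  shows "\<exists>xs. set xs \<subseteq> \<Delta> \<and> w = word xs"
  using assms
proof induction
  case id
  show ?case by (intro exI[of _ "[]"]) simp
next
  case (refl \<alpha> w)
  then obtain xs ys where "set xs \<subseteq> \<Delta>" "w = word xs" "set ys \<subseteq> \<Delta>" "reflection \<alpha> = word ys"
    using reflection_eq_word by blast
  then show ?case by (intro exI[of _ "ys @ xs"]) (auto simp: word_append)
qed

lemma word_weyl_group: "set xs \<subseteq> \<Phi> \<Longrightarrow> word xs \<in> weyl_group \<Phi>"
  by (induction xs) (auto intro: weyl_group.intros)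

lemma weyl_group_eq_words: "weyl_group \<Phi> = word ` {xs. set xs \<subseteq> \<Delta>}"
  using weyl_group_word word_weyl_group simple_subset by blast

text \<open>Appending a letter \<alpha> with \<open>v \<alpha>\<close> not positive gives an element
  with a shorter word, by \<open>exchange\<close>, and the induction on length covers it. So only
  steps with \<open>pos (v \<alpha>)\<close> remain.\<close>

lemma weyl_induct [consumes 1, case_names id step]:
  assumes "w \<in> weyl_group \<Phi>"
    and "P id"
    and "\<And>v \<alpha>. v \<in> weyl_group \<Phi> \<Longrightarrow> P v \<Longrightarrow> \<alpha> \<in> \<Delta> \<Longrightarrow> pos (v \<alpha>) \<Longrightarrow> P (v \<circ> reflection \<alpha>)"
  shows "P w"
proof -
  have "P (word xs)" if "set xs \<subseteq> \<Delta>" for xs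
    using that
  proof (induction xs rule: length_induct)
    case (1 xs)
    show ?case
    proof (cases xs rule: rev_cases)
      case Nil then show ?thesis using assms(2) by (simp add: id_def)
    next
      case (snoc ys \<alpha>)
      then have *: "set ys \<subseteq> \<Delta>" "\<alpha> \<in> \<Delta>" "word xs = word ys \<circ> reflection \<alpha>"
        using 1 by (auto simp: word_append)
      show ?thesis
      proof (cases "pos (word ys \<alpha>)")
        case True
        moreover have "P (word ys)" using 1 * snoc by simp
        moreover have "word ys \<in> weyl_group \<Phi>" using *(1) weyl_group_eq_words by blast
        ultimately show ?thesis using assms(3)[of "word ys" \<alpha>] * by metis
      next
        case False
        then obtain zs where "set zs \<subseteq> \<Delta>" "length zs < length ys" "word zs = word xs"
          using exchange[OF *(1,2)] *(3) by auto
        then show ?thesis using 1 snoc by (metis length_append_singleton less_SucI)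
      qed
    qed
  qed
  then show ?thesis using weyl_group_word[OF assms(1)] by blast
qed

subsection \<open>The action of the Weyl group\<close>

lemma weyl_orthogonal: "w \<in> weyl_group \<Phi> \<Longrightarrow> orthogonal_transformation w"
  using weyl_group_word orthogonal_transformation_word by blast

lemma weyl_linear: "w \<in> weyl_group \<Phi> \<Longrightarrow> linear w"
  using weyl_orthogonal orthogonal_transformation_linear by blast

lemma weyl_bij: "w \<in> weyl_group \<Phi> \<Longrightarrow> bij w"
  using weyl_orthogonal orthogonal_transformation_bij by blast

lemma weyl_inner: "w \<in> weyl_group \<Phi> \<Longrightarrow> w u \<bullet> w v = u \<bullet> v"
  using weyl_orthogonal by (simp add: orthogonal_transformation_def)

lemma weyl_root: "w \<in> weyl_group \<Phi> \<Longrightarrow> \<beta> \<in> \<Phi> \<Longrightarrow> w \<beta> \<in> \<Phi>"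
  using weyl_group_word simple_word_root by blast

lemma weyl_comp:
  assumes "u \<in> weyl_group \<Phi>" "v \<in> weyl_group \<Phi>"
  shows "u \<circ> v \<in> weyl_group \<Phi>"
  using assms(1)
proof induction
  case (refl \<alpha> u)
  then show ?case unfolding comp_assoc by (intro weyl_group.refl)
qed (simp add: assms(2))

lemma weyl_reflection: "\<alpha> \<in> \<Phi> \<Longrightarrow> reflection \<alpha> \<in> weyl_group \<Phi>"
  using weyl_group.refl[OF _ weyl_group.id] by simp

lemma weyl_inv:
  assumes "w \<in> weyl_group \<Phi>"
  shows "inv w \<in> weyl_group \<Phi>"
proof -
  obtain xs where xs: "set xs \<subseteq> \<Delta>" "w = word xs" using weyl_group_word assms by blast
  have "word (rev xs) \<in> weyl_group \<Phi>"
    using xs simple_subset by (intro word_weyl_group) auto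
  moreover have "inv w = word (rev xs)"
    using word_rev[of xs] word_rev[of "rev xs"] xs(2) by (intro inv_equality) auto
  ultimately show ?thesis by simp
qed

lemma weyl_inv_apply:
  assumes "w \<in> weyl_group \<Phi>"
  shows "w (inv w v) = v" "inv w (w v) = v"
  using weyl_bij[OF assms] by (simp_all add: bij_is_surj surj_f_inv_f bij_is_inj)

lemma weyl_inner_left: "w \<in> weyl_group \<Phi> \<Longrightarrow> w u \<bullet> v = u \<bullet> inv w v"
  using weyl_inner[of w u "inv w v"] by (simp add: weyl_inv_apply)

lemma bij_betw_weyl_right:
  assumes "u \<in> weyl_group \<Phi>"
  shows "bij_betw (\<lambda>w. w \<circ> u) (weyl_group \<Phi>) (weyl_group \<Phi>)"
  by (rule bij_betwI[where g = "\<lambda>w. w \<circ> inv u"])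
    (auto simp: assms weyl_comp weyl_inv fun_eq_iff weyl_inv_apply)

lemma bij_betw_weyl_inv: "bij_betw inv (weyl_group \<Phi>) (weyl_group \<Phi>)"
  by (rule bij_betwI[where g = inv]) (auto simp: weyl_inv inv_inv_eq weyl_bij)

text \<open>The group acts faithfully on the roots, because they are finite in number and span the
  space.\<close>

lemma finite_weyl_group: "finite (weyl_group \<Phi>)"
proof (rule inj_on_finite)
  show "inj_on (\<lambda>w. restrict w \<Phi>) (weyl_group \<Phi>)"
  proof (rule inj_onI)
    fix u v assume uv: "u \<in> weyl_group \<Phi>" "v \<in> weyl_group \<Phi>" "restrict u \<Phi> = restrict v \<Phi>"
    then have "u \<beta> = v \<beta>" if "\<beta> \<in> \<Phi>" for \<beta>
      using that by (metis restrict_apply')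
    then show "u = v"
      using linear_eq_on_span[of u v \<Phi>] uv weyl_linear span_roots by (auto simp: fun_eq_iff)
  qed
  show "(\<lambda>w. restrict w \<Phi>) ` weyl_group \<Phi> \<subseteq> Pi\<^sub>E \<Phi> (\<lambda>_. \<Phi>)"
    using weyl_root by auto
  show "finite (Pi\<^sub>E \<Phi> (\<lambda>_. \<Phi>))"
    using finite_roots by (simp add: finite_PiE)
qed

section \<open>Dominance and the action on chambers\<close>

lemma pos_add: "pos u \<Longrightarrow> pos v \<Longrightarrow> pos (u + v)"
  by (simp add: pos_def coef_add)

lemma pos_scaleR: "0 \<le> c \<Longrightarrow> pos v \<Longrightarrow> pos (c *\<^sub>R v)"
  by (simp add: pos_def coef_scaleR)

text \<open>A last step \<open>v \<circ> reflection \<alpha>\<close> would send \<alpha> to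
  \<open>- v \<alpha>\<close>, which is not positive.\<close>

lemma weyl_pos_imp_id:
  assumes "w \<in> weyl_group \<Phi>" "\<And>\<alpha>. \<alpha> \<in> \<Delta> \<Longrightarrow> pos (w \<alpha>)"
  shows "w = id"
  using assms
proof (induction rule: weyl_induct)
  case (step v \<alpha>)
  have "(v \<circ> reflection \<alpha>) \<alpha> = - v \<alpha>"
    using weyl_linear[OF step(1)] by (simp add: reflection_self linear_neg)
  moreover have "v \<alpha> \<noteq> 0"
    using weyl_root[OF step(1) simple_root] step zero_notin_roots by metis
  ultimately show ?case using step not_pos_and_neg by metis
qed auto

text \<open>Each step of the induction adds a nonnegative multiple of the positive root
  \<open>v \<alpha>\<close> to the difference.\<close>

lemma pos_dominant_diff_weyl:
  assumes "dominant_weight \<Delta> x" "w \<in> weyl_group \<Phi>"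
  shows "pos (x - w x)"
  using assms(2)
proof (induction rule: weyl_induct)
  case id
  show ?case by (simp add: pos_def coef_zero)
next
  case (step v \<alpha>)
  define k where "k = 2 * (x \<bullet> \<alpha>) / (\<alpha> \<bullet> \<alpha>)"
  have "k \<ge> 0" using assms(1) step by (simp add: k_def dominant_weight_def)
  have "x - (v \<circ> reflection \<alpha>) x = (x - v x) + k *\<^sub>R v \<alpha>"
    using weyl_linear[OF step(1)]
    by (simp add: reflection_def linear_diff linear_scale k_def)
  then show ?case using step \<open>k \<ge> 0\<close> by (simp only: pos_add pos_scaleR)
qed

text \<open>The open fundamental chamber.\<close>

definition strictly_dominant :: "'a \<Rightarrow> bool" where
  "strictly_dominant \<mu> \<longleftrightarrow> (\<forall>\<alpha>\<in>\<Delta>. \<mu> \<bullet> \<alpha> > 0)"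

lemma strictly_dominant_inner_pos:
  assumes "strictly_dominant \<mu>" "pos v" "v \<noteq> 0"
  shows "\<mu> \<bullet> v > 0"
proof -
  have nonneg: "coef \<alpha> v * (\<mu> \<bullet> \<alpha>) \<ge> 0" if "\<alpha> \<in> \<Delta>" for \<alpha>
    using assms that by (simp add: strictly_dominant_def pos_def less_imp_le)
  have "\<exists>\<alpha>\<in>\<Delta>. coef \<alpha> v \<noteq> 0"
  proof (rule ccontr)
    assume "\<not> ?thesis"
    then have "(\<Sum>\<alpha>\<in>\<Delta>. coef \<alpha> v *\<^sub>R \<alpha>) = 0" by simp
    then show False using assms(3) by (simp only: sum_coef)
  qed
  then obtain \<alpha> where "\<alpha> \<in> \<Delta>" "coef \<alpha> v > 0"
    using assms(2) by (force simp: pos_def)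
  then show ?thesis
    unfolding inner_coef[of \<mu> v] using assms(1) nonneg finite_simple
    by (intro sum_pos2[of \<Delta> \<alpha>]) (auto simp: strictly_dominant_def)
qed

lemma strictly_dominant_pos_iff:
  assumes "strictly_dominant \<mu>" "\<beta> \<in> \<Phi>"
  shows "\<mu> \<bullet> \<beta> > 0 \<longleftrightarrow> pos \<beta>"
proof -
  have "\<beta> \<noteq> 0" using assms(2) zero_notin_roots by auto
  moreover have "\<mu> \<bullet> \<beta> < 0" if "pos (- \<beta>)"
    using strictly_dominant_inner_pos[OF assms(1) that] \<open>\<beta> \<noteq> 0\<close> by simp
  ultimately show ?thesis
    using strictly_dominant_inner_pos[OF assms(1)] pos_or_neg[OF assms(2)] by fastforce
qed

lemma regular_weight_weyl:
  assumes "regular_weight \<Phi> v" "w \<in> weyl_group \<Phi>"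
  shows "regular_weight \<Phi> (w v)"
  using assms weyl_inner_left[OF assms(2)] weyl_root[OF weyl_inv[OF assms(2)]]
  by (simp add: regular_weight_def)

text \<open>Take the orbit point with the largest coordinate sum. A simple reflection lowers this
  sum by a positive multiple of the pairing with the simple root, so the maximum has nonnegative
  pairings, and regularity makes them strict.\<close>

lemma regular_weight_conj_strictly_dominant:
  assumes "regular_weight \<Phi> v"
  shows "\<exists>w\<in>weyl_group \<Phi>. strictly_dominant (w v)"
proof -
  define h where "h u = (\<Sum>\<alpha>\<in>\<Delta>. coef \<alpha> u)" for u
  define m where "m = Max ((\<lambda>w. h (w v)) ` weyl_group \<Phi>)"
  have "m \<in> (\<lambda>w. h (w v)) ` weyl_group \<Phi>"
    unfolding m_def using finite_weyl_group weyl_group.id by (intro Max_in) auto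
  then obtain w where w: "w \<in> weyl_group \<Phi>" "h (w v) = m" by auto
  have max: "h (u v) \<le> h (w v)" if "u \<in> weyl_group \<Phi>" for u
    unfolding w(2) m_def using finite_weyl_group that by (intro Max_ge) auto
  have "w v \<bullet> \<alpha> > 0" if \<alpha>: "\<alpha> \<in> \<Delta>" for \<alpha>
  proof -
    define k where "k = 2 * (w v \<bullet> \<alpha>) / (\<alpha> \<bullet> \<alpha>)"
    have "h (reflection \<alpha> (w v)) = (\<Sum>\<delta>\<in>\<Delta>. coef \<delta> (w v) - (if \<delta> = \<alpha> then k else 0))"
      unfolding h_def using \<alpha>
      by (intro sum.cong) (auto simp: reflection_def coef_diff coef_scaleR coef_simple k_def)
    also have "\<dots> = h (w v) - k"
      using \<alpha> finite_simple by (simp add: sum_subtractf h_def)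
    finally have "k \<ge> 0"
      using max[OF weyl_comp[OF weyl_reflection[OF simple_root[OF \<alpha>]] w(1)]] by simp
    then have "w v \<bullet> \<alpha> \<ge> 0"
      using simple_nonzero[OF \<alpha>] inner_gt_zero_iff[of \<alpha>]
      by (auto simp: k_def zero_le_divide_iff simp del: inner_gt_zero_iff)
    moreover have "w v \<bullet> \<alpha> \<noteq> 0"
      using regular_weight_weyl[OF assms w(1)] simple_root[OF \<alpha>] by (auto simp: regular_weight_def)
    ultimately show ?thesis by simp
  qed
  then show ?thesis using w(1) by (auto simp: strictly_dominant_def)
qed

text \<open>The element \<open>u \<circ> inv w\<close> takes the chamber point \<open>w v\<close> to
  the chamber point \<open>u v\<close>, so it keeps the simple roots positive and is the identity.
  Inside the polytope this leaves exactly one unflipped cone.\<close>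

lemma strictly_dominant_conj_unique:
  assumes "u \<in> weyl_group \<Phi>" "w \<in> weyl_group \<Phi>"
    and "strictly_dominant (u v)" "strictly_dominant (w v)"
  shows "u = w"
proof -
  let ?g = "u \<circ> inv w"
  have g: "?g \<in> weyl_group \<Phi>" using assms weyl_comp weyl_inv by blast
  have "pos (?g \<alpha>)" if "\<alpha> \<in> \<Delta>" for \<alpha>
  proof -
    have "u v \<bullet> ?g \<alpha> = w v \<bullet> \<alpha>"
      using assms by (simp add: weyl_inner weyl_inner_left)
    then have "u v \<bullet> ?g \<alpha> > 0"
      using assms(4) that by (simp add: strictly_dominant_def)
    then show ?thesis
      using strictly_dominant_pos_iff[OF assms(3) weyl_root[OF g simple_root[OF that]]] by simp
  qed
  then have "?g = id" using weyl_pos_imp_id g by blast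
  then have "u (inv w y) = y" for y by (metis comp_apply id_apply)
  then show ?thesis using weyl_inv_apply(2)[OF assms(2)] by (metis ext)
qed

subsection \<open>The signed cone decomposition\<close>

text \<open>With these half-open sides the two values differ by exactly 1 for every
  \<open>b\<close>, so that the cone identity holds at every point and not just almost
  everywhere.\<close>

definition signed_side :: "bool \<Rightarrow> real \<Rightarrow> real" where
  "signed_side s b = (if s then of_bool (b \<ge> 0) else - of_bool (b < 0))"

text \<open>The signed indicator of the cone at \<open>x\<close> spanned by the negative simple roots, with those
  generators \<open>- \<alpha>\<close> reversed on which \<open>\<mu>\<close> increases.\<close>

definition cone_fun :: "'a \<Rightarrow> 'a \<Rightarrow> 'a \<Rightarrow> real" where
  "cone_fun x \<mu> y = (\<Prod>\<alpha>\<in>\<Delta>. signed_side (\<mu> \<bullet> \<alpha> > 0) (coef \<alpha> (x - y)))"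

definition cone_sum :: "'a \<Rightarrow> 'a \<Rightarrow> 'a \<Rightarrow> real" where
  "cone_sum x \<mu> y = (\<Sum>w\<in>weyl_group \<Phi>. cone_fun x (w \<mu>) (w y))"

lemma cone_sum_weyl:
  assumes "u \<in> weyl_group \<Phi>"
  shows "cone_sum x (u \<mu>) (u y) = cone_sum x \<mu> y"
  unfolding cone_sum_def
  using sum.reindex_bij_betw[OF bij_betw_weyl_right[OF assms], of "\<lambda>w. cone_fun x (w \<mu>) (w y)"]
  by simp

text \<open>Only the factor of \<alpha> tells \<tau> from its reflection, and there the two values
  differ by 1, with a sign that depends on \<tau> alone. Reflecting \<open>y\<close> moves it along
  \<alpha> and leaves the product \<open>R\<close> of the other factors unchanged. Both differences
  are therefore the same signed \<open>R\<close>.\<close>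

lemma cone_fun_pair_cancel:
  assumes \<alpha>: "\<alpha> \<in> \<Delta>" and "\<tau> \<bullet> \<alpha> \<noteq> 0"
    and same: "\<And>\<beta>. \<beta> \<in> \<Delta> \<Longrightarrow> \<beta> \<noteq> \<alpha> \<Longrightarrow> reflection \<alpha> \<tau> \<bullet> \<beta> > 0 \<longleftrightarrow> \<tau> \<bullet> \<beta> > 0"
  shows "cone_fun x \<tau> y - cone_fun x (reflection \<alpha> \<tau>) y
       = cone_fun x \<tau> (reflection \<alpha> y) - cone_fun x (reflection \<alpha> \<tau>) (reflection \<alpha> y)"
proof -
  define R where "R = (\<Prod>\<beta>\<in>\<Delta> - {\<alpha>}. signed_side (\<tau> \<bullet> \<beta> > 0) (coef \<beta> (x - y)))"
  have coef: "coef \<beta> (x - reflection \<alpha> y) = coef \<beta> (x - y)" if "\<beta> \<noteq> \<alpha>" for \<beta>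
    using \<alpha> that by (simp add: reflection_def coef_diff coef_scaleR coef_simple)
  have split: "cone_fun x \<nu> z = signed_side (\<nu> \<bullet> \<alpha> > 0) (coef \<alpha> (x - z)) * R"
    if "\<nu> \<in> {\<tau>, reflection \<alpha> \<tau>}" "z \<in> {y, reflection \<alpha> y}" for \<nu> z
  proof -
    have "signed_side (\<nu> \<bullet> \<beta> > 0) (coef \<beta> (x - z)) = signed_side (\<tau> \<bullet> \<beta> > 0) (coef \<beta> (x - y))"
      if "\<beta> \<in> \<Delta> - {\<alpha>}" for \<beta>
      using that \<open>\<nu> \<in> _\<close> \<open>z \<in> _\<close> same coef by auto
    then show ?thesis
      unfolding cone_fun_def R_def
      using prod.remove[OF finite_simple \<alpha>, of "\<lambda>\<beta>. signed_side (\<nu> \<bullet> \<beta> > 0) (coef \<beta> (x - z))"]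
      by simp
  qed
  have "reflection \<alpha> \<tau> \<bullet> \<alpha> = - (\<tau> \<bullet> \<alpha>)"
    by (simp add: reflection_inner reflection_self)
  then show ?thesis
    using assms(2) by (auto simp: split signed_side_def not_less)
qed

text \<open>The wall-crossing step, between the fundamental chamber and its neighbour across the
  wall of \<open>a\<close>.\<close>

lemma cone_sum_reflection:
  assumes \<mu>: "strictly_dominant \<mu>" and a: "a \<in> \<Delta>"
  shows "cone_sum x (reflection a \<mu>) z = cone_sum x \<mu> z"
proof -
  \<comment> \<open>\<open>D t\<close> is the change of the term of \<open>t\<close> at the wall.
    \<open>T \<alpha>\<close> collects the \<open>t\<close> whose cone has its generator at \<alpha>
    flipped by the crossing.\<close>
  define D where "D t = cone_fun x (t \<mu>) (t z) - cone_fun x (t (reflection a \<mu>)) (t z)" for t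
  define T where "T \<alpha> = {t \<in> weyl_group \<Phi>. t a \<in> span {\<alpha>}}" for \<alpha>
  have a_root: "a \<in> \<Phi>" using a simple_root by blast
  have sign: "t (reflection a \<mu>) \<bullet> \<beta> > 0 \<longleftrightarrow> t \<mu> \<bullet> \<beta> > 0"
    if t: "t \<in> weyl_group \<Phi>" and \<beta>: "\<beta> \<in> \<Delta>" and "t a \<notin> span {\<beta>}" for t \<beta>
  proof -
    \<comment> \<open>Pulled back to \<mu>, the two pairings are those with the root
      \<open>?\<gamma>\<close> and with its reflection in \<open>a\<close>. Their signs agree off
      the line of \<open>a\<close>.\<close>
    let ?\<gamma> = "inv t \<beta>"
    have \<gamma>: "?\<gamma> \<in> \<Phi>" using weyl_root weyl_inv t simple_root \<beta> by blast
    have "?\<gamma> \<notin> span {a}"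
    proof
      assume "?\<gamma> \<in> span {a}"
      then obtain k where k: "?\<gamma> = k *\<^sub>R a" by (auto simp: span_singleton)
      then have "\<beta> = k *\<^sub>R t a"
        using weyl_inv_apply(1)[OF t, of \<beta>] weyl_linear[OF t] by (simp add: linear_scale)
      moreover from this have "k \<noteq> 0" using simple_nonzero[OF \<beta>] by auto
      ultimately have "t a = (1 / k) *\<^sub>R \<beta>" by simp
      then show False using that(3) by (auto simp: span_singleton)
    qed
    then show ?thesis
      using strictly_dominant_pos_iff[OF \<mu>] \<gamma> a reflection_root[OF a_root \<gamma>]
        pos_reflection_simple_iff[OF \<gamma> a]
      by (simp add: weyl_inner_left[OF t] reflection_inner)
  qed
  have T_span: "\<exists>c. t a = c *\<^sub>R \<alpha>" if "t \<in> T \<alpha>" for t \<alpha>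
    using that by (auto simp: T_def span_singleton)
  have conj: "t (reflection a v) = reflection \<alpha> (t v)" if "t \<in> T \<alpha>" for t \<alpha> v
  proof -
    obtain c where c: "t a = c *\<^sub>R \<alpha>" using T_span \<open>t \<in> T \<alpha>\<close> by blast
    have t: "t \<in> weyl_group \<Phi>" using that by (simp add: T_def)
    then have "c \<noteq> 0" using c weyl_root[OF t a_root] zero_notin_roots by auto
    then show ?thesis
      using orthogonal_transformation_conj_reflection[OF weyl_orthogonal[OF t], of a v] c
      by (simp add: reflection_scaleR)
  qed
  have T_unique: "\<alpha> = \<beta>" if "t \<in> T \<alpha>" "t \<in> T \<beta>" "\<alpha> \<in> \<Delta>" "\<beta> \<in> \<Delta>" for t \<alpha> \<beta>
  proof (rule ccontr)
    assume "\<alpha> \<noteq> \<beta>"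
    obtain c d where "t a = c *\<^sub>R \<alpha>" "t a = d *\<^sub>R \<beta>"
      using T_span \<open>t \<in> T \<alpha>\<close> \<open>t \<in> T \<beta>\<close> by meson
    then have "coef \<alpha> (c *\<^sub>R \<alpha>) = coef \<alpha> (d *\<^sub>R \<beta>)" by simp
    then have "c = 0" using \<open>\<alpha> \<noteq> \<beta>\<close> that(3,4) by (simp add: coef_scaleR coef_simple)
    then have "0 \<in> \<Phi>" using \<open>t a = c *\<^sub>R \<alpha>\<close> weyl_root[of t a] that(1) a_root by (simp add: T_def)
    then show False using zero_notin_roots by blast
  qed
  have T_zero: "(\<Sum>t\<in>T \<alpha>. D t) = 0" if \<alpha>: "\<alpha> \<in> \<Delta>" for \<alpha>
  proof -
    have refl_T: "reflection \<alpha> \<circ> t \<in> T \<alpha>" if "t \<in> T \<alpha>" for t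
    proof -
      have "reflection \<alpha> (t a) = - t a"
        using that conj[OF that, of a] weyl_linear[of t]
        by (simp add: reflection_self T_def linear_neg)
      then show ?thesis
        using that \<alpha> simple_root by (auto simp: T_def span_neg intro!: weyl_comp weyl_reflection)
    qed
    have bij: "bij_betw (\<lambda>t. reflection \<alpha> \<circ> t) (T \<alpha>) (T \<alpha>)"
      by (rule bij_betwI[where g = "\<lambda>t. reflection \<alpha> \<circ> t"]) (auto simp: refl_T fun_eq_iff)
    \<comment> \<open>For \<tau> = \<open>t \<mu>\<close>, passing from \<open>t\<close> to
      \<open>reflection \<alpha> \<circ> t\<close> swaps \<tau> with its reflection and reflects the
      point. The swap negates the difference, and by \<open>cone_fun_pair_cancel\<close> moving the
      point does not change it.\<close>
    have "D (reflection \<alpha> \<circ> t) = - D t" if t: "t \<in> T \<alpha>" for t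
    proof -
      have tW: "t \<in> weyl_group \<Phi>" using t by (simp add: T_def)
      have same: "reflection \<alpha> (t \<mu>) \<bullet> \<beta> > 0 \<longleftrightarrow> t \<mu> \<bullet> \<beta> > 0"
        if "\<beta> \<in> \<Delta>" "\<beta> \<noteq> \<alpha>" for \<beta>
      proof -
        have "t a \<notin> span {\<beta>}" using T_unique[OF t _ \<alpha>] that tW by (auto simp: T_def)
        from sign[OF tW that(1) this] show ?thesis by (simp add: conj[OF t])
      qed
      have "inv t \<alpha> \<in> \<Phi>" using weyl_root weyl_inv tW simple_root \<alpha> by blast
      moreover from this have "inv t \<alpha> \<noteq> 0" using zero_notin_roots by metis
      ultimately have "t \<mu> \<bullet> \<alpha> \<noteq> 0"
        using strictly_dominant_inner_pos[OF \<mu>, of "inv t \<alpha>"] pos_or_neg[of "inv t \<alpha>"]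
          strictly_dominant_inner_pos[OF \<mu>, of "- inv t \<alpha>"]
        by (auto simp: weyl_inner_left[OF tW])
      from cone_fun_pair_cancel[OF \<alpha> this same, of x "t z"] show ?thesis
        by (simp add: D_def conj[OF t])
    qed
    then have "(\<Sum>t\<in>T \<alpha>. D t) = - (\<Sum>t\<in>T \<alpha>. D t)"
      using sum.reindex_bij_betw[OF bij, of D] by (simp add: sum_negf)
    then show ?thesis by simp
  qed
  have "D t = 0" if "t \<in> weyl_group \<Phi>" "t \<notin> (\<Union>\<alpha>\<in>\<Delta>. T \<alpha>)" for t
  proof -
    have "t (reflection a \<mu>) \<bullet> \<beta> > 0 \<longleftrightarrow> t \<mu> \<bullet> \<beta> > 0" if "\<beta> \<in> \<Delta>" for \<beta>
      using sign[of t \<beta>] \<open>t \<in> weyl_group \<Phi>\<close> \<open>t \<notin> _\<close> that by (auto simp: T_def)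
    then show ?thesis by (simp add: D_def cone_fun_def)
  qed
  then have "(\<Sum>t\<in>weyl_group \<Phi>. D t) = (\<Sum>t\<in>(\<Union>\<alpha>\<in>\<Delta>. T \<alpha>). D t)"
    by (intro sum.mono_neutral_right finite_weyl_group) (auto simp: T_def)
  also have "\<dots> = (\<Sum>\<alpha>\<in>\<Delta>. \<Sum>t\<in>T \<alpha>. D t)"
    using finite_simple finite_weyl_group T_unique
    by (intro sum.UNION_disjoint) (auto simp: T_def)
  also have "\<dots> = 0" by (simp add: T_zero)
  finally show ?thesis by (simp add: cone_sum_def D_def sum_subtractf)
qed

lemma cone_sum_strictly_dominant_cong:
  assumes "strictly_dominant \<mu>" "strictly_dominant \<nu>"
  shows "cone_sum x \<mu> z = cone_sum x \<nu> z"
proof -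
  have "w \<mu> \<bullet> \<alpha> > 0 \<longleftrightarrow> w \<nu> \<bullet> \<alpha> > 0" if "w \<in> weyl_group \<Phi>" "\<alpha> \<in> \<Delta>" for w \<alpha>
    using strictly_dominant_pos_iff[OF assms(1)] strictly_dominant_pos_iff[OF assms(2)]
      weyl_root[OF weyl_inv[OF that(1)] simple_root[OF that(2)]]
    by (simp add: weyl_inner_left[OF that(1)])
  then show ?thesis unfolding cone_sum_def cone_fun_def by (intro sum.cong prod.cong) auto
qed

text \<open>By invariance a letter can be moved from the weight to the point, so only walls of the
  fundamental chamber are ever crossed. This is why the induction needs arbitrary
  \<open>z\<close>.\<close>

lemma cone_sum_word:
  assumes "strictly_dominant \<mu>" "set xs \<subseteq> \<Delta>"
  shows "cone_sum x (word xs \<mu>) z = cone_sum x \<mu> z"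
  using assms(2)
proof (induction xs arbitrary: z)
  case (Cons a xs)
  have a: "a \<in> \<Delta>" "reflection a \<in> weyl_group \<Phi>"
    using Cons.prems weyl_reflection simple_root by auto
  have "cone_sum x (word (a # xs) \<mu>) z = cone_sum x (word xs \<mu>) (reflection a z)"
    using cone_sum_weyl[OF a(2), of x "word xs \<mu>" "reflection a z"] by simp
  also have "\<dots> = cone_sum x \<mu> (reflection a z)" using Cons by simp
  also have "\<dots> = cone_sum x (reflection a \<mu>) z"
    using cone_sum_weyl[OF a(2), of x \<mu> "reflection a z"] by simp
  also have "\<dots> = cone_sum x \<mu> z" using cone_sum_reflection assms(1) a(1) by blast
  finally show ?case .
qed simp

lemma cone_sum_regular_cong:
  assumes "regular_weight \<Phi> u" "regular_weight \<Phi> v"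
  shows "cone_sum x u z = cone_sum x v z"
proof -
  have *: "\<exists>\<mu>. strictly_dominant \<mu> \<and> cone_sum x v z = cone_sum x \<mu> z"
    if v: "regular_weight \<Phi> v" for v
  proof -
    obtain w where w: "w \<in> weyl_group \<Phi>" "strictly_dominant (w v)"
      using regular_weight_conj_strictly_dominant[OF v] by blast
    obtain xs where "set xs \<subseteq> \<Delta>" "inv w = word xs"
      using weyl_group_word[OF weyl_inv[OF w(1)]] by blast
    then have "cone_sum x v z = cone_sum x (w v) z"
      using cone_sum_word[OF w(2), of xs x z] weyl_inv_apply(2)[OF w(1), of v] by simp
    then show ?thesis using w(2) by blast
  qed
  show ?thesis using *[OF assms(1)] *[OF assms(2)] cone_sum_strictly_dominant_cong by metis
qed

text \<open>The condition is convex in the point and holds at the vertices. Dominance of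
  \<open>x\<close> enters the decomposition here.\<close>

lemma pos_diff_weyl_polytope:
  assumes "dominant_weight \<Delta> x" "y \<in> weight_polytope \<Phi> x" "w \<in> weyl_group \<Phi>"
  shows "pos (x - w y)"
proof -
  have "weight_polytope \<Phi> x \<subseteq> {z. pos (x - w z)}"
    unfolding weight_polytope_def
  proof (rule hull_minimal)
    show "(\<lambda>u. u x) ` weyl_group \<Phi> \<subseteq> {z. pos (x - w z)}"
      using pos_dominant_diff_weyl[OF assms(1)] weyl_comp[OF assms(3)] by fastforce
    show "convex {z. pos (x - w z)}"
    proof (rule convexI)
      fix z z' :: 'a and s t :: real
      assume *: "z \<in> {z. pos (x - w z)}" "z' \<in> {z. pos (x - w z)}" "0 \<le> s" "0 \<le> t" "s + t = 1"
      have "x - w (s *\<^sub>R z + t *\<^sub>R z') = s *\<^sub>R (x - w z) + t *\<^sub>R (x - w z')"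
        using weyl_linear[OF assms(3)] * 
        by (simp add: linear_add linear_scale algebra_simps flip: scaleR_add_left)
      then show "s *\<^sub>R z + t *\<^sub>R z' \<in> {z. pos (x - w z)}"
        using * by (simp add: pos_add pos_scaleR)
    qed
  qed
  then show ?thesis using assms(2) by blast
qed

text \<open>A separating functional may vanish on roots, so it is perturbed by a small positive
  multiple of \<open>u\<close>. Roots on which it vanishes are then detected by \<open>u\<close>,
  while nonzero pairings and the finitely many strict inequalities survive. The sign of
  \<open>a\<close> is reversed because \<open>a\<close> is smaller at \<open>y\<close> than on the
  hull.\<close>

lemma separating_regular_weight:
  assumes "finite V" "y \<notin> convex hull V" "regular_weight \<Phi> u"
  obtains v where "regular_weight \<Phi> v" "\<And>z. z \<in> V \<Longrightarrow> v \<bullet> z < v \<bullet> y"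
proof -
  have "closed (convex hull V)"
    using assms(1) by (simp add: compact_imp_closed finite_imp_compact_convex_hull)
  then obtain a b where ab: "a \<bullet> y < b" "\<And>z. z \<in> convex hull V \<Longrightarrow> b < a \<bullet> z"
    using separating_hyperplane_closed_point[of "convex hull V" y] assms(2) by auto
  have 1: "\<forall>\<^sub>F e in at_right 0. \<forall>\<alpha>\<in>\<Phi>. (- a + e *\<^sub>R u) \<bullet> \<alpha> \<noteq> 0"
  proof (rule eventually_ball_finite[OF finite_roots], rule ballI)
    fix \<alpha> assume \<alpha>: "\<alpha> \<in> \<Phi>"
    have lim: "((\<lambda>e. (- a + e *\<^sub>R u) \<bullet> \<alpha>) \<longlongrightarrow> (- a + 0 *\<^sub>R u) \<bullet> \<alpha>) (at_right 0)"
      by (intro tendsto_intros)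
    show "\<forall>\<^sub>F e in at_right 0. (- a + e *\<^sub>R u) \<bullet> \<alpha> \<noteq> 0"
    proof (cases "a \<bullet> \<alpha> = 0")
      case True
      have "u \<bullet> \<alpha> \<noteq> 0" using assms(3) \<alpha> by (simp add: regular_weight_def)
      then show ?thesis
        using True eventually_at_right_less[of "0::real"]
        by (auto elim!: eventually_mono simp: inner_simps)
    next
      case False
      then show ?thesis using tendsto_imp_eventually_ne[OF lim, of 0] by simp
    qed
  qed
  have 2: "\<forall>\<^sub>F e in at_right 0. \<forall>z\<in>V. 0 < (- a + e *\<^sub>R u) \<bullet> (y - z)"
  proof (rule eventually_ball_finite[OF assms(1)], rule ballI)
    fix z assume "z \<in> V"
    then have "a \<bullet> y < a \<bullet> z" using ab hull_inc[of z V convex] by force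
    moreover have "((\<lambda>e. (- a + e *\<^sub>R u) \<bullet> (y - z)) \<longlongrightarrow> (- a + 0 *\<^sub>R u) \<bullet> (y - z)) (at_right 0)"
      by (intro tendsto_intros)
    ultimately show "\<forall>\<^sub>F e in at_right 0. 0 < (- a + e *\<^sub>R u) \<bullet> (y - z)"
      by (intro order_tendstoD(1)) (auto simp: inner_simps)
  qed
  obtain e where "\<forall>\<alpha>\<in>\<Phi>. (- a + e *\<^sub>R u) \<bullet> \<alpha> \<noteq> 0" "\<forall>z\<in>V. 0 < (- a + e *\<^sub>R u) \<bullet> (y - z)"
    using eventually_happens'[OF _ eventually_conj[OF 1 2]] by auto
  then show ?thesis
    by (intro that[of "- a + e *\<^sub>R u"]) (auto simp: regular_weight_def inner_diff_right)
qed

theorem cone_sum_eq_indicator: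
  assumes x: "dominant_weight \<Delta> x" and u: "regular_weight \<Phi> u"
  shows "cone_sum x u y = indicator (weight_polytope \<Phi> x) y"
proof (cases "y \<in> weight_polytope \<Phi> x")
  case True
  obtain w0 where w0: "w0 \<in> weyl_group \<Phi>" "strictly_dominant (w0 u)"
    using regular_weight_conj_strictly_dominant[OF u] by blast
  have "cone_fun x (w u) (w y) = (if w = w0 then 1 else 0)" if w: "w \<in> weyl_group \<Phi>" for w
  proof -
    \<comment> \<open>All coordinates of \<open>x - w y\<close> are nonnegative, so an unflipped
      side gives 1 and a flipped side 0.\<close>
    have "cone_fun x (w u) (w y) = (\<Prod>\<alpha>\<in>\<Delta>. of_bool (w u \<bullet> \<alpha> > 0))"
      unfolding cone_fun_def using pos_diff_weyl_polytope[OF x True w]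
      by (intro prod.cong) (auto simp: signed_side_def pos_def)
    also have "\<dots> = of_bool (strictly_dominant (w u))"
      using finite_simple by (auto simp: strictly_dominant_def intro!: prod.neutral)
    finally show ?thesis
      using strictly_dominant_conj_unique[OF w w0(1)] w0(2) by auto
  qed
  then have "cone_sum x u y = (\<Sum>w\<in>weyl_group \<Phi>. if w = w0 then 1 else 0)"
    unfolding cone_sum_def by (intro sum.cong) simp_all
  then show ?thesis using w0 finite_weyl_group True by simp
next
  case False
  obtain v where v: "regular_weight \<Phi> v" "\<And>w. w \<in> weyl_group \<Phi> \<Longrightarrow> v \<bullet> w x < v \<bullet> y"
    using separating_regular_weight[OF finite_imageI[OF finite_weyl_group] _ u] False
    unfolding weight_polytope_def by (metis imageI)
  have "cone_fun x (w v) (w y) = 0" if w: "w \<in> weyl_group \<Phi>" for w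
  proof (rule ccontr)
    assume "cone_fun x (w v) (w y) \<noteq> 0"
    then have "signed_side (w v \<bullet> \<alpha> > 0) (coef \<alpha> (x - w y)) \<noteq> 0" if "\<alpha> \<in> \<Delta>" for \<alpha>
      using finite_simple that by (auto simp: cone_fun_def)
    \<comment> \<open>A nonzero factor forces its coordinate and its pairing to have weakly the same
      sign. Summing over \<Delta> then contradicts the separation at the vertex
      \<open>inv w x\<close>.\<close>
    then have "coef \<alpha> (x - w y) * (w v \<bullet> \<alpha>) \<ge> 0" if "\<alpha> \<in> \<Delta>" for \<alpha>
      using that by (fastforce simp: signed_side_def zero_le_mult_iff split: if_splits)
    then have "w v \<bullet> (x - w y) \<ge> 0"
      unfolding inner_coef[of "w v" "x - w y"] by (rule sum_nonneg)
    then have "v \<bullet> inv w x \<ge> v \<bullet> y"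
      using w by (simp add: inner_diff_right weyl_inner weyl_inner_left)
    then show False using v(2)[OF weyl_inv[OF w]] by simp
  qed
  then have "cone_sum x v y = 0" by (simp add: cone_sum_def)
  then show ?thesis using cone_sum_regular_cong[OF u v(1), of x y] False by simp
qed

subsection \<open>Volumes\<close>

text \<open>The basis change \<open>f\<close> scales volume by the volume of the fundamental parallelepiped, which
  is the image of the unit cube; the region below is the image of the standard simplex.\<close>

lemma parallelepiped_simplex:
  fixes a :: "'a \<Rightarrow> real" and x :: 'a
  assumes a: "\<And>\<alpha>. \<alpha> \<in> \<Delta> \<Longrightarrow> a \<alpha> \<noteq> 0" and K: "K > 0"
  defines "S \<equiv> {y. (\<forall>\<alpha>\<in>\<Delta>. a \<alpha> * coef \<alpha> (x - y) \<ge> 0) \<and> (\<Sum>\<alpha>\<in>\<Delta>. a \<alpha> * coef \<alpha> (x - y)) \<le> K}"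
  shows "measure lebesgue (parallelepiped \<Delta>) > 0" and "compact S"
    and "measure lebesgue S
       = K ^ DIM('a) / (fact DIM('a) * (\<Prod>\<alpha>\<in>\<Delta>. \<bar>a \<alpha>\<bar>)) * measure lebesgue (parallelepiped \<Delta>)"
proof -
  obtain e where e: "bij_betw e (Basis :: 'a set) \<Delta>"
    using finite_same_card_bij[OF finite_Basis finite_simple] card_simple by auto
  then have e_in: "e b \<in> \<Delta>" if "b \<in> Basis" for b using that by (auto simp: bij_betw_def)
  define f :: "'a \<Rightarrow> 'a" where "f v = (\<Sum>b\<in>Basis. (v \<bullet> b) *\<^sub>R e b)" for v
  have f: "linear f"
    by (rule linearI) (simp_all add: f_def inner_simps algebra_simps sum.distrib scaleR_sum_right)
  have coef_f: "coef (e b) (f v) = v \<bullet> b" if b: "b \<in> Basis" for b v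
  proof -
    have "coef (e b) (f v) = (\<Sum>c\<in>Basis. if c = b then v \<bullet> b else 0)"
      unfolding f_def coef_sum using b e_in bij_betw_imp_inj_on[OF e]
      by (intro sum.cong) (auto simp: coef_scaleR coef_simple inj_on_eq_iff)
    then show ?thesis using b by simp
  qed
  have sum_e: "(\<Sum>b\<in>Basis. g (e b)) = (\<Sum>\<alpha>\<in>\<Delta>. g \<alpha>)" for g :: "'a \<Rightarrow> 'b::comm_monoid_add"
    using sum.reindex_bij_betw[OF e] .
  have "inj f"
    by (rule injI, rule euclidean_eqI) (metis coef_f)
  then obtain c where "c > 0" and c: "\<And>S. compact S \<Longrightarrow> measure lebesgue (f ` S) = c * measure lebesgue S"
    using measure_linear_image_compact f by blast
  have "parallelepiped \<Delta> = f ` cbox 0 One"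
  proof (intro set_eqI iffI)
    fix y assume "y \<in> parallelepiped \<Delta>"
    then obtain g where g: "y = (\<Sum>\<alpha>\<in>\<Delta>. g \<alpha> *\<^sub>R \<alpha>)" "\<forall>\<alpha>\<in>\<Delta>. 0 \<le> g \<alpha> \<and> g \<alpha> \<le> 1"
      unfolding parallelepiped_def by blast
    define v where "v = (\<Sum>b\<in>Basis. g (e b) *\<^sub>R b)"
    have v: "v \<bullet> b = g (e b)" if "b \<in> Basis" for b
      using that by (simp add: v_def)
    then have "v \<in> cbox 0 One" using g(2) e_in by (simp add: mem_box)
    moreover have "f v = y"
      unfolding f_def g(1) sum_e[of "\<lambda>\<alpha>. g \<alpha> *\<^sub>R \<alpha>", symmetric] using v by (intro sum.cong) auto
    ultimately show "y \<in> f ` cbox 0 One" by blast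
  next
    fix y assume "y \<in> f ` cbox 0 One"
    then obtain v where v: "y = f v" "v \<in> cbox 0 One" by blast
    have "coef \<alpha> y \<in> {0..1}" if "\<alpha> \<in> \<Delta>" for \<alpha>
      using that e v coef_f by (auto simp: bij_betw_def mem_box)
    then show "y \<in> parallelepiped \<Delta>"
      unfolding parallelepiped_def using sum_coef[of y]
      by (intro CollectI exI[of _ "\<lambda>\<alpha>. coef \<alpha> y"]) auto
  qed
  then have D: "measure lebesgue (parallelepiped \<Delta>) = c"
    using c[of "cbox 0 One"] by simp
  then show "measure lebesgue (parallelepiped \<Delta>) > 0" using \<open>c > 0\<close> by simp
  \<comment> \<open>Scaled so that \<open>v\<close> in the standard simplex goes to the point
    \<open>y\<close> with \<open>a \<alpha> * coef \<alpha> (x - y)\<close> equal to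
    \<open>K\<close> times a coordinate of \<open>v\<close>. The minus sign comes from measuring
    from \<open>y\<close> to the apex \<open>x\<close>.\<close>
  define d where "d b = - (K / a (e b))" for b
  define T where "T v = (\<Sum>b\<in>Basis. (d b * (v \<bullet> b)) *\<^sub>R b)" for v :: 'a
  define X where "X = convex hull (insert 0 Basis :: 'a set)"
  have X: "compact X" unfolding X_def by (intro finite_imp_compact_convex_hull) auto
  have T_inner: "T v \<bullet> b = d b * (v \<bullet> b)" if "b \<in> Basis" for v b
    using that by (simp add: T_def)
  have S_eq: "S = (+) x ` f ` T ` X"
  proof (intro set_eqI iffI)
    fix y assume y: "y \<in> S"
    define v where "v = (\<Sum>b\<in>Basis. (a (e b) * coef (e b) (x - y) / K) *\<^sub>R b)"
    have v: "v \<bullet> b = a (e b) * coef (e b) (x - y) / K" if "b \<in> Basis" for b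
      using that by (simp add: v_def)
    have "(\<Sum>b\<in>Basis. v \<bullet> b) = (\<Sum>b\<in>Basis. a (e b) * coef (e b) (x - y)) / K"
      unfolding sum_divide_distrib using v by (intro sum.cong) auto
    also have "\<dots> \<le> 1"
      using y K unfolding sum_e[of "\<lambda>\<alpha>. a \<alpha> * coef \<alpha> (x - y)"] by (simp add: S_def)
    finally have "v \<in> X"
      unfolding X_def std_simplex using v y e_in K by (auto simp: S_def inner_commute)
    moreover have "f (T v) = - (\<Sum>b\<in>Basis. coef (e b) (x - y) *\<^sub>R e b)"
      unfolding f_def sum_negf[symmetric] using a[OF e_in] K
      by (intro sum.cong) (auto simp: T_inner v d_def)
    then have "x + f (T v) = y"
      unfolding sum_e[of "\<lambda>\<alpha>. coef \<alpha> (x - y) *\<^sub>R \<alpha>"] sum_coef by simp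
    ultimately show "y \<in> (+) x ` f ` T ` X" by (metis imageI)
  next
    fix y assume "y \<in> (+) x ` f ` T ` X"
    then obtain v where v: "v \<in> X" and y: "y = x + f (T v)" by blast
    have coef: "a (e b) * coef (e b) (x - y) = K * (v \<bullet> b)" if "b \<in> Basis" for b
      using that a[OF e_in[OF that]] by (simp add: y coef_minus coef_f T_inner d_def)
    have "a \<alpha> * coef \<alpha> (x - y) \<ge> 0" if "\<alpha> \<in> \<Delta>" for \<alpha>
    proof -
      obtain b where "b \<in> Basis" "\<alpha> = e b" using \<open>\<alpha> \<in> \<Delta>\<close> e by (auto simp: bij_betw_def)
      then show ?thesis using coef v K by (simp add: X_def std_simplex inner_commute)
    qed
    moreover have "(\<Sum>\<alpha>\<in>\<Delta>. a \<alpha> * coef \<alpha> (x - y)) = K * (\<Sum>b\<in>Basis. v \<bullet> b)"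
      unfolding sum_distrib_left using coef
      by (subst sum_e[of "\<lambda>\<alpha>. a \<alpha> * coef \<alpha> (x - y)", symmetric]) (rule sum.cong[OF HOL.refl])
    moreover have "(\<Sum>b\<in>Basis. v \<bullet> b) \<le> 1"
      using v by (simp add: X_def std_simplex inner_commute)
    ultimately show "y \<in> S" using K by (simp add: S_def)
  qed
  have "linear T"
    by (rule linearI) (simp_all add: T_def inner_simps algebra_simps sum.distrib scaleR_sum_right)
  then have TX: "compact (T ` X)"
    using X by (simp add: compact_continuous_image linear_continuous_on linear_linear)
  then have fTX: "compact (f ` T ` X)"
    using f by (simp add: compact_continuous_image linear_continuous_on linear_linear)
  then show "compact S"
    unfolding S_eq by (rule compact_translation)
  have "measure lebesgue S = c * measure lebesgue (T ` X)"
    unfolding S_eq measure_translation by (rule c[OF TX])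
  also have "measure lebesgue (T ` X) = (\<Prod>b\<in>Basis. \<bar>d b\<bar>) * measure lebesgue X"
    unfolding T_def using a[OF e_in] K by (intro measure_diagonal_image_compact X) (simp add: d_def)
  also have "measure lebesgue X = 1 / fact DIM('a)"
    using content_std_simplex X unfolding X_def by (simp add: measure_completion compact_imp_closed)
  also have "(\<Prod>b\<in>Basis. \<bar>d b\<bar>) = (\<Prod>b\<in>Basis. K / \<bar>a (e b)\<bar>)"
    using K by (simp add: d_def abs_divide)
  also have "\<dots> = K ^ DIM('a) / (\<Prod>\<alpha>\<in>\<Delta>. \<bar>a \<alpha>\<bar>)"
    using prod.reindex_bij_betw[OF e, of "\<lambda>\<alpha>. \<bar>a \<alpha>\<bar>"] by (simp add: prod_dividef)
  finally show "measure lebesgue S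
       = K ^ DIM('a) / (fact DIM('a) * (\<Prod>\<alpha>\<in>\<Delta>. \<bar>a \<alpha>\<bar>)) * measure lebesgue (parallelepiped \<Delta>)"
    by (simp add: D mult_ac)
qed

section \<open>Integrals of the truncated cones\<close>

lemma negligible_coef: "\<alpha> \<in> \<Delta> \<Longrightarrow> negligible {y. coef \<alpha> (x - y) = 0}"
proof -
  assume \<alpha>: "\<alpha> \<in> \<Delta>"
  define n where "n = adjoint (coef \<alpha>) 1"
  have n: "coef \<alpha> v = n \<bullet> v" for v
    using adjoint_works[OF linear_coef, of v \<alpha> 1] by (simp add: n_def inner_commute)
  have "n \<noteq> 0" using n[of \<alpha>] \<alpha> by (auto simp: coef_simple)
  then have "negligible {y. n \<bullet> y = n \<bullet> x}" using negligible_hyperplane by blast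
  moreover have "{y. coef \<alpha> (x - y) = 0} = {y. n \<bullet> y = n \<bullet> x}"
    by (auto simp: n inner_diff_right)
  ultimately show ?thesis by simp
qed

text \<open>Away from the wall \<open>b = 0\<close> the half-open sides agree with the closed ones
  that bound the simplices.\<close>

lemma signed_side_eq_sgn:
  assumes "s \<noteq> 0" "b \<noteq> 0"
  shows "signed_side (s > 0) b = sgn s * of_bool (s * b \<ge> 0)"
proof (cases "s > 0")
  case True
  then show ?thesis by (simp add: signed_side_def zero_le_mult_iff)
next
  case False
  then have "s < 0" using assms(1) by simp
  then show ?thesis using assms(2) by (simp add: signed_side_def zero_le_mult_iff less_le)
qed

text \<open>Off the walls collected in \<open>N\<close>, the integrand is a constant sign times the
  indicator of a rotated simplex.\<close>

lemma cone_fun_has_integral: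
  assumes u: "regular_weight \<Phi> u" and w: "w \<in> weyl_group \<Phi>" and K: "w u \<bullet> x + M > 0"
  shows "((\<lambda>y. cone_fun x (w u) (w y) * indicator {y. u \<bullet> y \<ge> - M} y) has_integral
    (w u \<bullet> x + M) ^ DIM('a) / (fact DIM('a) * (\<Prod>\<alpha>\<in>\<Delta>. w u \<bullet> \<alpha>)) * measure lebesgue (parallelepiped \<Delta>)) UNIV"
proof -
  let ?a = "\<lambda>\<alpha>. w u \<bullet> \<alpha>"
  have a: "?a \<alpha> \<noteq> 0" if "\<alpha> \<in> \<Delta>" for \<alpha>
    using regular_weight_weyl[OF u w] simple_root[OF that] by (simp add: regular_weight_def)
  define S where "S = {y. (\<forall>\<alpha>\<in>\<Delta>. ?a \<alpha> * coef \<alpha> (x - y) \<ge> 0) \<and> (\<Sum>\<alpha>\<in>\<Delta>. ?a \<alpha> * coef \<alpha> (x - y)) \<le> w u \<bullet> x + M}"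
  have S: "compact S" "measure lebesgue S = (w u \<bullet> x + M) ^ DIM('a)
      / (fact DIM('a) * (\<Prod>\<alpha>\<in>\<Delta>. \<bar>?a \<alpha>\<bar>)) * measure lebesgue (parallelepiped \<Delta>)"
    unfolding S_def
    using parallelepiped_simplex(2)[where a = ?a, OF _ K] parallelepiped_simplex(3)[where a = ?a, OF _ K] a
    by blast+
  define N where "N = (\<Union>\<alpha>\<in>\<Delta>. {y. coef \<alpha> (x - y) = 0})"
  have orth: "orthogonal_transformation (inv w)" and lin: "linear (inv w)"
    using weyl_inv[OF w] weyl_orthogonal weyl_linear by auto
  have mem: "y \<in> inv w ` A \<longleftrightarrow> w y \<in> A" for y A
  proof
    show "y \<in> inv w ` A" if "w y \<in> A"
      using imageI[OF that, of "inv w"] by (simp add: weyl_inv_apply[OF w])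
  qed (auto simp: weyl_inv_apply[OF w])
  have "negligible N"
    unfolding N_def using finite_simple negligible_coef by (intro negligible_Union) auto
  then have N: "negligible (inv w ` N)"
    by (rule negligible_differentiable_image_negligible[OF order_refl])
      (rule linear_imp_differentiable_on[OF lin])
  have SN: "compact (inv w ` S)"
    using S(1) lin by (simp add: compact_continuous_image linear_continuous_on linear_linear)
  have mS: "measure lebesgue (inv w ` S) = measure lebesgue S"
    using measure_orthogonal_image_compact[OF orth S(1)] .
  have *: "((\<lambda>y. (\<Prod>\<alpha>\<in>\<Delta>. sgn (?a \<alpha>)) * indicator (inv w ` S) y) has_integral
      (\<Prod>\<alpha>\<in>\<Delta>. sgn (?a \<alpha>)) * measure lebesgue S) UNIV"
    using lmeasurable_compact[OF SN] unfolding lmeasurable_iff_has_integral mS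
    by (rule has_integral_mult_right)
  have "cone_fun x (w u) (w y) * indicator {y. u \<bullet> y \<ge> - M} y
      = (\<Prod>\<alpha>\<in>\<Delta>. sgn (?a \<alpha>)) * indicator (inv w ` S) y" if y: "y \<notin> inv w ` N" for y
  proof -
    have "coef \<alpha> (x - w y) \<noteq> 0" if "\<alpha> \<in> \<Delta>" for \<alpha>
      using y that by (auto simp: mem N_def)
    then have "cone_fun x (w u) (w y) = (\<Prod>\<alpha>\<in>\<Delta>. sgn (?a \<alpha>) * of_bool (?a \<alpha> * coef \<alpha> (x - w y) \<ge> 0))"
      unfolding cone_fun_def using a
      by (intro prod.cong[OF HOL.refl] signed_side_eq_sgn) blast+
    also have "\<dots> = (\<Prod>\<alpha>\<in>\<Delta>. sgn (?a \<alpha>)) * of_bool (\<forall>\<alpha>\<in>\<Delta>. ?a \<alpha> * coef \<alpha> (x - w y) \<ge> 0)"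
    proof -
      have "(\<Prod>\<alpha>\<in>\<Delta>. of_bool (?a \<alpha> * coef \<alpha> (x - w y) \<ge> 0))
          = (of_bool (\<forall>\<alpha>\<in>\<Delta>. ?a \<alpha> * coef \<alpha> (x - w y) \<ge> 0) :: real)"
        using finite_simple by auto
      then show ?thesis by (simp add: prod.distrib)
    qed
    finally have 1: "cone_fun x (w u) (w y)
      = (\<Prod>\<alpha>\<in>\<Delta>. sgn (?a \<alpha>)) * of_bool (\<forall>\<alpha>\<in>\<Delta>. ?a \<alpha> * coef \<alpha> (x - w y) \<ge> 0)" .
    \<comment> \<open>This turns the bound on the sum in \<open>S\<close> into the cutoff
      \<open>u \<bullet> y \<ge> - M\<close>.\<close>
    have "(\<Sum>\<alpha>\<in>\<Delta>. ?a \<alpha> * coef \<alpha> (x - w y)) = w u \<bullet> (x - w y)"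
      by (simp add: inner_coef[of _ "x - w y"] mult.commute)
    also have "\<dots> = w u \<bullet> x - u \<bullet> y"
      by (simp add: inner_diff_right weyl_inner[OF w])
    finally show ?thesis unfolding 1 by (auto simp: mem S_def indicator_def)
  qed
  then have integral: "((\<lambda>y. cone_fun x (w u) (w y) * indicator {y. u \<bullet> y \<ge> - M} y) has_integral
      (\<Prod>\<alpha>\<in>\<Delta>. sgn (?a \<alpha>)) * measure lebesgue S) UNIV"
    by (intro has_integral_spike[OF N _ *]) auto
  \<comment> \<open>The signs of the cone absorb the absolute values in the simplex volume, which
    leaves the signed product of the formula.\<close>
  have quot: "(\<Prod>\<alpha>\<in>\<Delta>. sgn (?a \<alpha>)) / (\<Prod>\<alpha>\<in>\<Delta>. \<bar>?a \<alpha>\<bar>) = 1 / (\<Prod>\<alpha>\<in>\<Delta>. ?a \<alpha>)"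
  proof -
    have "sgn (?a \<alpha>) / \<bar>?a \<alpha>\<bar> = 1 / ?a \<alpha>" if "\<alpha> \<in> \<Delta>" for \<alpha>
      using a[OF that] by (simp add: sgn_if)
    then have "(\<Prod>\<alpha>\<in>\<Delta>. sgn (?a \<alpha>) / \<bar>?a \<alpha>\<bar>) = (\<Prod>\<alpha>\<in>\<Delta>. 1 / ?a \<alpha>)"
      by (intro prod.cong) auto
    then show ?thesis by (simp only: prod_dividef prod.neutral_const)
  qed
  have cancel: "X * (P / (f * A) * D) = P / (f * E) * D" if "X / A = 1 / E" for X A E P f D :: real
  proof -
    have "X * (P / (f * A) * D) = X / A * (P / f * D)" by simp
    also have "\<dots> = P / (f * E) * D" unfolding that by simp
    finally show ?thesis .
  qed
  have "(\<Prod>\<alpha>\<in>\<Delta>. sgn (?a \<alpha>)) * measure lebesgue S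
      = (w u \<bullet> x + M) ^ DIM('a) / (fact DIM('a) * (\<Prod>\<alpha>\<in>\<Delta>. ?a \<alpha>)) * measure lebesgue (parallelepiped \<Delta>)"
    unfolding S(2) by (rule cancel[OF quot])
  with integral show ?thesis by (rule subst[rotated])
qed

text \<open>The cutoff misses the polytope, so the truncated signed sum is still its indicator and
  can be integrated term by term.\<close>

lemma measure_weight_polytope_shifted:
  assumes x: "dominant_weight \<Delta> x" and u: "regular_weight \<Phi> u"
    and M: "\<And>y. y \<in> weight_polytope \<Phi> x \<Longrightarrow> u \<bullet> y > - M"
  shows "measure lebesgue (weight_polytope \<Phi> x) = (\<Sum>w\<in>weyl_group \<Phi>.
    (w u \<bullet> x + M) ^ DIM('a) / (fact DIM('a) * (\<Prod>\<alpha>\<in>\<Delta>. w u \<bullet> \<alpha>)) * measure lebesgue (parallelepiped \<Delta>))"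
    (is "_ = (\<Sum>w\<in>_. ?c w)")
proof -
  have "w u \<bullet> x + M > 0" if w: "w \<in> weyl_group \<Phi>" for w
  proof -
    \<comment> \<open>The apex value \<open>w u \<bullet> x\<close> is the value of \<open>u\<close>
      at this vertex, so each truncated cone has positive height.\<close>
    have "inv w x \<in> weight_polytope \<Phi> x"
      unfolding weight_polytope_def using weyl_inv[OF w] by (intro hull_inc) blast
    from M[OF this] show ?thesis by (simp add: weyl_inner_left[OF w])
  qed
  then have "((\<lambda>y. \<Sum>w\<in>weyl_group \<Phi>. cone_fun x (w u) (w y) * indicator {y. u \<bullet> y \<ge> - M} y)
      has_integral (\<Sum>w\<in>weyl_group \<Phi>. ?c w)) UNIV"
    using cone_fun_has_integral[OF u] by (intro has_integral_sum finite_weyl_group) blast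
  moreover have "(\<Sum>w\<in>weyl_group \<Phi>. cone_fun x (w u) (w y) * indicator {y. u \<bullet> y \<ge> - M} y)
      = indicator (weight_polytope \<Phi> x) y" for y
  proof -
    have "(\<Sum>w\<in>weyl_group \<Phi>. cone_fun x (w u) (w y) * indicator {y. u \<bullet> y \<ge> - M} y)
        = cone_sum x u y * indicator {y. u \<bullet> y \<ge> - M} y"
      by (simp add: cone_sum_def sum_distrib_right)
    also have "\<dots> = indicator (weight_polytope \<Phi> x) y"
      unfolding cone_sum_eq_indicator[OF x u] using M[of y] by (auto simp: indicator_def)
    finally show ?thesis .
  qed
  ultimately have "(indicator (weight_polytope \<Phi> x) has_integral (\<Sum>w\<in>weyl_group \<Phi>. ?c w)) UNIV"
    by simp
  moreover have "weight_polytope \<Phi> x \<in> lmeasurable"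
    unfolding weight_polytope_def
    by (intro lmeasurable_compact finite_imp_compact_convex_hull finite_imageI finite_weyl_group)
  ultimately show ?thesis
    using lmeasurable_iff_has_integral has_integral_unique by blast
qed

end

text \<open>A polynomial in \<open>M\<close> that is constant on a ray is constant everywhere. This
  permits \<open>M = 0\<close>, where the cutoff may meet the polytope.\<close>

lemma sum_shifted_powers_constant:
  fixes c d :: "'i \<Rightarrow> real"
  assumes "\<And>M. M > M0 \<Longrightarrow> (\<Sum>i\<in>I. c i * (d i + M) ^ n) = V"
  shows "(\<Sum>i\<in>I. c i * d i ^ n) = V"
proof -
  define p where "p = (\<Sum>i\<in>I. smult (c i) ([:d i, 1:] ^ n)) - [:V:]"
  have p: "poly p M = (\<Sum>i\<in>I. c i * (d i + M) ^ n) - V" for M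
    by (simp add: p_def poly_sum)
  have "{M0<..} \<subseteq> {M. poly p M = 0}" using assms by (auto simp: p)
  then have "infinite {M. poly p M = 0}" using infinite_Ioi finite_subset by blast
  then have "p = 0" using poly_roots_finite by blast
  then show ?thesis using p[of 0] by simp
qed

theorem theorem4p2:
  fixes \<Phi> \<Delta> :: "'a::euclidean_space set" and x lam :: 'a and r :: nat
  assumes "root_system \<Phi>"
    and "dim \<Phi> = r"
    and "simple_roots \<Phi> \<Delta>"
    and "dominant_weight \<Delta> x"
    and "regular_weight \<Phi> lam"
  shows "Vol \<Delta> (weight_polytope \<Phi> x) =
    (1 / fact r) * (\<Sum>w\<in>weyl_group \<Phi>. (lam \<bullet> w x) ^ r / (\<Prod>\<alpha>\<in>\<Delta>. lam \<bullet> w \<alpha>))"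
proof -
  interpret simple_root_system \<Phi> \<Delta> by (rule simple_root_system.intro[OF assms(1,3)])
  let ?P = "weight_polytope \<Phi> x" and ?D = "measure lebesgue (parallelepiped \<Delta>)"
  have r: "r = DIM('a)"
    using assms(2) span_roots by (metis dim_UNIV dim_span)
  have "compact ?P"
    unfolding weight_polytope_def
    by (intro finite_imp_compact_convex_hull finite_imageI finite_weyl_group)
  then obtain B where B: "\<And>y. y \<in> ?P \<Longrightarrow> norm y \<le> B"
    using compact_imp_bounded bounded_iff by metis
  \<comment> \<open>By Cauchy-Schwarz, \<open>norm lam * B\<close> bounds the pairing with
    \<open>lam\<close> on the polytope, so any larger \<open>M\<close> is an admissible
    cutoff.\<close>
  have "(\<Sum>w\<in>weyl_group \<Phi>. ?D / (fact r * (\<Prod>\<alpha>\<in>\<Delta>. w lam \<bullet> \<alpha>)) * (w lam \<bullet> x + M) ^ r)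
      = measure lebesgue ?P" if M: "M > norm lam * B" for M
  proof -
    have "lam \<bullet> y > - M" if "y \<in> ?P" for y
    proof -
      have "\<bar>lam \<bullet> y\<bar> \<le> norm lam * B"
        using Cauchy_Schwarz_ineq2[of lam y] mult_left_mono[OF B[OF that], of "norm lam"] by simp
      then show ?thesis using M by linarith
    qed
    then show ?thesis
      by (subst measure_weight_polytope_shifted[OF assms(4,5)]) (auto simp: r intro!: sum.cong)
  qed
  then have "measure lebesgue ?P
    = (\<Sum>w\<in>weyl_group \<Phi>. ?D / (fact r * (\<Prod>\<alpha>\<in>\<Delta>. w lam \<bullet> \<alpha>)) * (w lam \<bullet> x) ^ r)"
    by (intro sum_shifted_powers_constant[symmetric])
  also have "\<dots> = ?D * (1 / fact r * (\<Sum>w\<in>weyl_group \<Phi>. (w lam \<bullet> x) ^ r / (\<Prod>\<alpha>\<in>\<Delta>. w lam \<bullet> \<alpha>)))"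
    by (simp add: sum_distrib_left mult_ac)
  \<comment> \<open>Move the group elements back from \<open>lam\<close> to \<open>x\<close> and the
    simple roots; inversion then permutes the summands.\<close>
  also have "(\<Sum>w\<in>weyl_group \<Phi>. (w lam \<bullet> x) ^ r / (\<Prod>\<alpha>\<in>\<Delta>. w lam \<bullet> \<alpha>))
    = (\<Sum>w\<in>weyl_group \<Phi>. (lam \<bullet> inv w x) ^ r / (\<Prod>\<alpha>\<in>\<Delta>. lam \<bullet> inv w \<alpha>))"
    by (intro sum.cong) (simp_all add: weyl_inner_left)
  also have "\<dots> = (\<Sum>w\<in>weyl_group \<Phi>. (lam \<bullet> w x) ^ r / (\<Prod>\<alpha>\<in>\<Delta>. lam \<bullet> w \<alpha>))"
    by (rule sum.reindex_bij_betw[OF bij_betw_weyl_inv])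
  \<comment> \<open>The instance with all \<open>a \<alpha>\<close> and \<open>K\<close> equal to 1
    supplies the positive volume of the parallelepiped, so that \<open>?D\<close> cancels.\<close>
  finally show ?thesis
    using parallelepiped_simplex(1)[of "\<lambda>_. 1" 1] by (simp add: Vol_def)
qed

end
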